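(* Let $X$ be a regular simplicial set. For each $n\ge 0$ and each $n$-simplex $y$ of $X$, the canonical map $$dcr: D\,T(B(\bar y))\to M(B(\bar y))$$ is an isomorphism, where $\bar y:\Delta[n]\to X$ is the representing map of $y$.
   Context: Conventions. For a simplicial set $X$, $x\in X_n$ and an operator (order-preserving map) $\alpha:[m]\to[n]$, write $x\alpha\in X_m$ for the result of applying $\alpha$ to $x$. $\Delta[n]$ is the standard $n$-simplex, and $\bar x:\Delta[n]\to X$ is the representing map of $x\in X_n$ (Yoneda). $\delta_n:[n-1]\to[n]$ is the injective operator omitting $n$. By the Eilenberg–Zilber lemma each simplex $x$ is uniquely $x=x^\sharp x^\flat$ with $x^\sharp$ non-degenerate and $x^\flat$ a degeneracy (surjective) operator. Regular. Let $y$ be a non-degenerate $n$-simplex of $X$ and $Y'\subseteq X$ the simplicial subset generated by $y\delta_n$. Form the pushout $\Delta[n]\sqcup_{\Delta[n-1]}Y'$ in $sSet$ of $\Delta[n]\xleftarrow{\delta_n}\Delta[n-1]\xrightarrow{\overline{y\delta_n}}Y'$. The simplex $y$ is regular if the canonical map $\Delta[n]\sqcup_{\Delta[n-1]}Y'\to X$ is degreewise injective (for $n=0$, $\Delta[-1]$ and $Y'$ are empty and the condition holds trivially). $X$ is regular if all of its non-degenerate simplices are regular. Barratt nerve. $X^\sharp$ is the poset of non-degenerate simplices of $X$, with $y\le x$ when $y$ is a face of $x$ (i.e. $y=x\mu$ for an injective operator $\mu$). A simplicial map $f$ induces $f^\sharp: x\mapsto f(x)^\sharp$. $N$ is the nerve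 (posets are regarded as small categories). $BX=N(X^\sharp)$, $B(f)=N(f^\sharp)$. Desingularization. A simplicial set is non-singular if the representing map of each of its non-degenerate simplices is degreewise injective. $nsSet\subseteq sSet$ is the full subcategory of non-singular simplicial sets; $D:sSet\to nsSet$ is the left adjoint of the inclusion, with unit $\eta$. The nerve of a poset is non-singular. Mapping cylinders. Let $\varphi:P\to R$ be an order-preserving map of posets and $i_0:P\to P\times[1]$, $p\mapsto(p,0)$. The (backwards) topological mapping cylinder is the pushout in $sSet$: $T(N\varphi)=N(P\times[1])\sqcup_{NP}NR$ (along $Ni_0$ and $N\varphi$). The (backwards) reduced mapping cylinder is $M(N\varphi)=N(P\times[1]\sqcup_P R)$, with the pushout (along $i_0$ and $\varphi$) taken in the category of posets. The canonical map $cr:T(N\varphi)\to M(N\varphi)$ is the cylinder reduction map; as $M(N\varphi)$ is non-singular, $cr$ factors uniquely through $\eta:T(N\varphi)\to D\,T(N\varphi)$, giving $dcr:D\,T(N\varphi)\to M(N\varphi)$. Here this is applied to $\varphi=(\bar y)^\sharp:\Delta[n]^\sharp\to X^\sharp$, so that $N\varphi=B(\bar y)$. *)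

theory Defs
  imports "HOL-Library.FuncSet"
begin

text \<open>
  A poset is a relation \<open>P\<close> with \<open>Partial_order P\<close>; its underlying set is \<open>Field P\<close>.
  The maps in \<open>order_maps P Q\<close> are taken in \<open>Field P \<rightarrow>\<^sub>E Field Q\<close>, so that equality of maps is equality
  in HOL.
\<close>

definition ordinal :: "nat \<Rightarrow> nat rel" where
  "ordinal n = {(i, j). i \<le> j \<and> j \<le> n}"

definition order_preserving :: "'p rel \<Rightarrow> 'q rel \<Rightarrow> ('p \<Rightarrow> 'q) \<Rightarrow> bool" where
  "order_preserving P Q f \<longleftrightarrow>
     f \<in> Field P \<rightarrow> Field Q \<and> (\<forall>x y. (x, y) \<in> P \<longrightarrow> (f x, f y) \<in> Q)"

definition order_maps :: "'p rel \<Rightarrow> 'q rel \<Rightarrow> ('p \<Rightarrow> 'q) set" where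
  "order_maps P Q = {f \<in> Field P \<rightarrow>\<^sub>E Field Q. order_preserving P Q f}"

text \<open>Operators from \<open>[m]\<close> to \<open>[n]\<close>.\<close>

abbreviation ops :: "nat \<Rightarrow> nat \<Rightarrow> (nat \<Rightarrow> nat) set" where
  "ops m n \<equiv> order_maps (ordinal m) (ordinal n)"

definition id_op :: "nat \<Rightarrow> nat \<Rightarrow> nat" where
  "id_op n = (\<lambda>i\<in>{..n}. i)"

text \<open>\<open>coface k i\<close> is the injective operator from \<open>[k]\<close> to \<open>[k + 1]\<close> omitting \<open>i\<close>.\<close>

definition coface :: "nat \<Rightarrow> nat \<Rightarrow> nat \<Rightarrow> nat" where
  "coface k i = (\<lambda>j\<in>{..k}. if j < i then j else Suc j)"

text \<open>
  \<open>act X n m x \<alpha>\<close> is \<open>x\<alpha>\<close> for an \<open>n\<close>-simplex \<open>x\<close> and \<open>\<alpha>\<close> from \<open>[m]\<close> to \<open>[n]\<close>. The degrees are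
  arguments because neither the sets of simplices of different degrees nor the sets of operators
  with different sources are required to be disjoint.
\<close>

record 'a sset =
  smp :: "nat \<Rightarrow> 'a set"
  act :: "nat \<Rightarrow> nat \<Rightarrow> 'a \<Rightarrow> (nat \<Rightarrow> nat) \<Rightarrow> 'a"

locale simplicial_set =
  fixes X :: "'a sset"
  assumes act_closed: "x \<in> smp X n \<Longrightarrow> \<alpha> \<in> ops m n \<Longrightarrow> act X n m x \<alpha> \<in> smp X m"
    and act_id: "x \<in> smp X n \<Longrightarrow> act X n n x (id_op n) = x"
    and act_comp: "x \<in> smp X n \<Longrightarrow> \<alpha> \<in> ops m n \<Longrightarrow> \<beta> \<in> ops k m \<Longrightarrow>
      act X m k (act X n m x \<alpha>) \<beta> = act X n k x (compose {..k} \<alpha> \<beta>)"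

text \<open>
  The values of \<open>f n\<close> outside \<open>smp X n\<close> are irrelevant; maps are compared on simplices only.
\<close>

definition simplicial_map :: "'a sset \<Rightarrow> 'b sset \<Rightarrow> (nat \<Rightarrow> 'a \<Rightarrow> 'b) \<Rightarrow> bool" where
  "simplicial_map X Y f \<longleftrightarrow>
     (\<forall>n. f n \<in> smp X n \<rightarrow> smp Y n) \<and>
     (\<forall>n m. \<forall>x\<in>smp X n. \<forall>\<alpha>\<in>ops m n. f m (act X n m x \<alpha>) = act Y n m (f n x) \<alpha>)"

definition degreewise_injective :: "'a sset \<Rightarrow> (nat \<Rightarrow> 'a \<Rightarrow> 'b) \<Rightarrow> bool" where
  "degreewise_injective X f \<longleftrightarrow> (\<forall>n. inj_on (f n) (smp X n))"

definition simplicial_iso :: "'a sset \<Rightarrow> 'b sset \<Rightarrow> (nat \<Rightarrow> 'a \<Rightarrow> 'b) \<Rightarrow> bool" where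
  "simplicial_iso X Y f \<longleftrightarrow> simplicial_map X Y f \<and>
     (\<exists>g. simplicial_map Y X g \<and>
          (\<forall>n. \<forall>x\<in>smp X n. g n (f n x) = x) \<and> (\<forall>n. \<forall>y\<in>smp Y n. f n (g n y) = y))"

definition nerve :: "'p rel \<Rightarrow> (nat \<Rightarrow> 'p) sset" where
  "nerve P = \<lparr>smp = (\<lambda>n. order_maps (ordinal n) P), act = (\<lambda>n m x \<alpha>. compose {..m} x \<alpha>)\<rparr>"

definition nerve_map :: "('p \<Rightarrow> 'q) \<Rightarrow> nat \<Rightarrow> (nat \<Rightarrow> 'p) \<Rightarrow> nat \<Rightarrow> 'q" where
  "nerve_map \<phi> n x = compose {..n} \<phi> x"

text \<open>The \<open>m\<close>-simplices of \<open>\<Delta>[n]\<close> are the operators from \<open>[m]\<close> to \<open>[n]\<close>.\<close>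

definition std_simplex :: "nat \<Rightarrow> (nat \<Rightarrow> nat) sset" where
  "std_simplex n = nerve (ordinal n)"

definition repr_map :: "'a sset \<Rightarrow> nat \<Rightarrow> 'a \<Rightarrow> nat \<Rightarrow> (nat \<Rightarrow> nat) \<Rightarrow> 'a" where
  "repr_map X n x m \<alpha> = act X n m x \<alpha>"

definition nondeg :: "'a sset \<Rightarrow> nat \<Rightarrow> 'a set" where
  "nondeg X n = {x \<in> smp X n.
     \<not> (\<exists>m<n. \<exists>w\<in>smp X m. \<exists>\<sigma>\<in>ops n m. \<sigma> ` {..n} = {..m} \<and> x = act X m n w \<sigma>)}"

text \<open>
  The non-degenerate part \<open>x\<^sup>\<sharp>\<close> of the Eilenberg--Zilber decomposition, recorded with its degree;
  see \<open>eilenberg_zilber\<close> below for existence and uniqueness.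
\<close>

definition sharp :: "'a sset \<Rightarrow> nat \<Rightarrow> 'a \<Rightarrow> nat \<times> 'a" where
  "sharp X n x = (THE p. \<exists>m w. p = (m, w) \<and> w \<in> nondeg X m \<and>
     (\<exists>\<sigma>\<in>ops n m. \<sigma> ` {..n} = {..m} \<and> x = act X m n w \<sigma>))"

definition sharp_poset :: "'a sset \<Rightarrow> (nat \<times> 'a) rel" where
  "sharp_poset X = {((m, y), (n, x)). y \<in> nondeg X m \<and> x \<in> nondeg X n \<and>
     (\<exists>\<mu>\<in>ops m n. inj_on \<mu> {..m} \<and> y = act X n m x \<mu>)}"

definition sharp_map :: "'b sset \<Rightarrow> (nat \<Rightarrow> 'a \<Rightarrow> 'b) \<Rightarrow> nat \<times> 'a \<Rightarrow> nat \<times> 'b" where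
  "sharp_map Y f = (\<lambda>(n, x). sharp Y n (f n x))"

definition nonsingular :: "'a sset \<Rightarrow> bool" where
  "nonsingular X \<longleftrightarrow> (\<forall>n. \<forall>x\<in>nondeg X n. degreewise_injective (std_simplex n) (repr_map X n x))"


subsection \<open>Quotients and pushouts\<close>

definition congruence :: "'a sset \<Rightarrow> (nat \<Rightarrow> 'a rel) \<Rightarrow> bool" where
  "congruence X E \<longleftrightarrow> (\<forall>n. equiv (smp X n) (E n)) \<and>
     (\<forall>n m x x' \<alpha>. (x, x') \<in> E n \<longrightarrow> \<alpha> \<in> ops m n \<longrightarrow>
        (act X n m x \<alpha>, act X n m x' \<alpha>) \<in> E m)"

definition quot :: "'a sset \<Rightarrow> (nat \<Rightarrow> 'a rel) \<Rightarrow> 'a set sset" where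
  "quot X E = \<lparr>smp = (\<lambda>n. smp X n // E n),
     act = (\<lambda>n m c \<alpha>. \<Union>x\<in>c. E m `` {act X n m x \<alpha>})\<rparr>"

definition quot_proj :: "(nat \<Rightarrow> 'a rel) \<Rightarrow> nat \<Rightarrow> 'a \<Rightarrow> 'a set" where
  "quot_proj E n x = E n `` {x}"

text \<open>The map on a quotient induced by a map that is constant on classes.\<close>

definition quot_desc :: "(nat \<Rightarrow> 'a \<Rightarrow> 'b) \<Rightarrow> nat \<Rightarrow> 'a set \<Rightarrow> 'b" where
  "quot_desc f n c = the_elem (f n ` c)"

definition coprod :: "'a sset \<Rightarrow> 'b sset \<Rightarrow> ('a + 'b) sset" where
  "coprod X Y = \<lparr>smp = (\<lambda>n. smp X n <+> smp Y n),
     act = (\<lambda>n m s \<alpha>. map_sum (\<lambda>x. act X n m x \<alpha>) (\<lambda>y. act Y n m y \<alpha>) s)\<rparr>"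

definition glue :: "'c sset \<Rightarrow> 'a sset \<Rightarrow> 'b sset \<Rightarrow> (nat \<Rightarrow> 'c \<Rightarrow> 'a) \<Rightarrow> (nat \<Rightarrow> 'c \<Rightarrow> 'b) \<Rightarrow>
    nat \<Rightarrow> ('a + 'b) rel" where
  "glue A X Y f g n =
     (let G = (\<lambda>a. (Inl (f n a), Inr (g n a))) ` smp A n
      in (Id_on (smp X n <+> smp Y n) \<union> G \<union> G\<inverse>)\<^sup>+)"

text \<open>The pushout of \<open>f : A \<rightarrow> X\<close> and \<open>g : A \<rightarrow> Y\<close>.\<close>

definition pushout :: "'c sset \<Rightarrow> 'a sset \<Rightarrow> 'b sset \<Rightarrow> (nat \<Rightarrow> 'c \<Rightarrow> 'a) \<Rightarrow> (nat \<Rightarrow> 'c \<Rightarrow> 'b) \<Rightarrow>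
    ('a + 'b) set sset" where
  "pushout A X Y f g = quot (coprod X Y) (glue A X Y f g)"

definition pushout_desc :: "(nat \<Rightarrow> 'a \<Rightarrow> 'd) \<Rightarrow> (nat \<Rightarrow> 'b \<Rightarrow> 'd) \<Rightarrow> nat \<Rightarrow> ('a + 'b) set \<Rightarrow> 'd" where
  "pushout_desc u v = quot_desc (\<lambda>n. case_sum (u n) (v n))"

text \<open>
  The pushout of posets along \<open>f : A \<rightarrow> P\<close> and \<open>g : A \<rightarrow> Q\<close> is the poset reflection of the
  preorder generated on the disjoint union by the two orders and the identifications
  \<open>f a = g a\<close>.
\<close>

definition poset_glue :: "'c rel \<Rightarrow> 'p rel \<Rightarrow> 'q rel \<Rightarrow> ('c \<Rightarrow> 'p) \<Rightarrow> ('c \<Rightarrow> 'q) \<Rightarrow> ('p + 'q) rel" where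
  "poset_glue A P Q f g =
     (let G = (\<lambda>a. (Inl (f a), Inr (g a))) ` Field A
      in (map_prod Inl Inl ` P \<union> map_prod Inr Inr ` Q \<union> G \<union> G\<inverse>)\<^sup>+)"

definition poset_class :: "'c rel \<Rightarrow> 'p rel \<Rightarrow> 'q rel \<Rightarrow> ('c \<Rightarrow> 'p) \<Rightarrow> ('c \<Rightarrow> 'q) \<Rightarrow>
    'p + 'q \<Rightarrow> ('p + 'q) set" where
  "poset_class A P Q f g s = (poset_glue A P Q f g \<inter> (poset_glue A P Q f g)\<inverse>) `` {s}"

definition poset_pushout :: "'c rel \<Rightarrow> 'p rel \<Rightarrow> 'q rel \<Rightarrow> ('c \<Rightarrow> 'p) \<Rightarrow> ('c \<Rightarrow> 'q) \<Rightarrow>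
    ('p + 'q) set rel" where
  "poset_pushout A P Q f g =
     map_prod (poset_class A P Q f g) (poset_class A P Q f g) ` poset_glue A P Q f g"

definition prod_order :: "'p rel \<Rightarrow> 'q rel \<Rightarrow> ('p \<times> 'q) rel" where
  "prod_order P Q = {((p, q), (p', q')). (p, p') \<in> P \<and> (q, q') \<in> Q}"


subsection \<open>Regular simplicial sets\<close>

definition generated :: "'a sset \<Rightarrow> nat \<Rightarrow> 'a \<Rightarrow> 'a sset" where
  "generated X n x = \<lparr>smp = (\<lambda>m. (\<lambda>\<alpha>. act X n m x \<alpha>) ` ops m n), act = act X\<rparr>"

definition regular_simplex :: "'a sset \<Rightarrow> nat \<Rightarrow> 'a \<Rightarrow> bool" where
  "regular_simplex X n y \<longleftrightarrow>
     (\<forall>k. n = Suc k \<longrightarrow>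
        (let d = coface k n; z = act X n k y d; Y' = generated X k z
         in degreewise_injective
              (pushout (std_simplex k) (std_simplex n) Y' (nerve_map d) (repr_map Y' k z))
              (pushout_desc (repr_map X n y) (\<lambda>m x. x))))"

definition regular :: "'a sset \<Rightarrow> bool" where
  "regular X \<longleftrightarrow> (\<forall>n. \<forall>y\<in>nondeg X n. regular_simplex X n y)"


subsection \<open>Desingularization\<close>

text \<open>
  Non-singular simplicial sets are closed under products and simplicial subsets, so that the
  reflection of \<open>X\<close> is its largest non-singular quotient; see \<open>nonsingular_desing\<close> and
  \<open>desing_universal\<close> below.
\<close>

definition desing_rel :: "'a sset \<Rightarrow> nat \<Rightarrow> 'a rel" where
  "desing_rel X n = {(x, x'). x \<in> smp X n \<and> x' \<in> smp X n \<and>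
     (\<forall>E. congruence X E \<and> nonsingular (quot X E) \<longrightarrow> (x, x') \<in> E n)}"

definition desing :: "'a sset \<Rightarrow> 'a set sset" where
  "desing X = quot X (desing_rel X)"

definition desing_unit :: "'a sset \<Rightarrow> nat \<Rightarrow> 'a \<Rightarrow> 'a set" where
  "desing_unit X = quot_proj (desing_rel X)"


subsection \<open>Mapping cylinders\<close>

definition top_cylinder :: "'p rel \<Rightarrow> 'r rel \<Rightarrow> ('p \<Rightarrow> 'r) \<Rightarrow>
    ((nat \<Rightarrow> 'p \<times> nat) + (nat \<Rightarrow> 'r)) set sset" where
  "top_cylinder P R \<phi> =
     pushout (nerve P) (nerve (prod_order P (ordinal 1))) (nerve R)
       (nerve_map (\<lambda>p. (p, 0))) (nerve_map \<phi>)"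

definition red_cylinder :: "'p rel \<Rightarrow> 'r rel \<Rightarrow> ('p \<Rightarrow> 'r) \<Rightarrow>
    (nat \<Rightarrow> ('p \<times> nat + 'r) set) sset" where
  "red_cylinder P R \<phi> = nerve (poset_pushout P (prod_order P (ordinal 1)) R (\<lambda>p. (p, 0)) \<phi>)"

definition cr :: "'p rel \<Rightarrow> 'r rel \<Rightarrow> ('p \<Rightarrow> 'r) \<Rightarrow> nat \<Rightarrow>
    ((nat \<Rightarrow> 'p \<times> nat) + (nat \<Rightarrow> 'r)) set \<Rightarrow> nat \<Rightarrow> ('p \<times> nat + 'r) set" where
  "cr P R \<phi> =
     (let j = poset_class P (prod_order P (ordinal 1)) R (\<lambda>p. (p, 0)) \<phi>
      in pushout_desc (nerve_map (\<lambda>s. j (Inl s))) (nerve_map (\<lambda>r. j (Inr r))))"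

text \<open>
  The map on \<open>desing (top_cylinder P R \<phi>)\<close> induced by \<open>cr P R \<phi>\<close>; see \<open>dcr_unique\<close> below.
\<close>

definition dcr :: "'p rel \<Rightarrow> 'r rel \<Rightarrow> ('p \<Rightarrow> 'r) \<Rightarrow> nat \<Rightarrow>
    ((nat \<Rightarrow> 'p \<times> nat) + (nat \<Rightarrow> 'r)) set set \<Rightarrow> nat \<Rightarrow> ('p \<times> nat + 'r) set" where
  "dcr P R \<phi> = quot_desc (cr P R \<phi>)"

subsection \<open>The definitions have the expected properties\<close>

lemma Field_ordinal [simp]: "Field (ordinal n) = {..n}"
  by (auto simp: ordinal_def Field_def)

lemma ordinal_iff [simp]: "(i, j) \<in> ordinal n \<longleftrightarrow> i \<le> j \<and> j \<le> n"
  by (simp add: ordinal_def)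

lemma ops_iff:
  "\<alpha> \<in> ops m n \<longleftrightarrow> \<alpha> \<in> {..m} \<rightarrow>\<^sub>E {..n} \<and> (\<forall>i j. i \<le> j \<and> j \<le> m \<longrightarrow> \<alpha> i \<le> \<alpha> j)"
  by (auto simp: order_maps_def order_preserving_def PiE_iff Pi_def)

lemma ops_le: "\<alpha> \<in> ops m n \<Longrightarrow> i \<le> m \<Longrightarrow> \<alpha> i \<le> n"
  by (auto simp: ops_iff PiE_iff)

lemma ops_mono: "\<alpha> \<in> ops m n \<Longrightarrow> i \<le> j \<Longrightarrow> j \<le> m \<Longrightarrow> \<alpha> i \<le> \<alpha> j"
  by (auto simp: ops_iff)

lemma ops_ext: "\<alpha> \<in> ops m n \<Longrightarrow> \<beta> \<in> ops m n' \<Longrightarrow> (\<And>i. i \<le> m \<Longrightarrow> \<alpha> i = \<beta> i) \<Longrightarrow> \<alpha> = \<beta>"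
  by (rule extensionalityI[where A = "{..m}"]) (auto simp: ops_iff PiE_iff)

lemma id_op [intro, simp]: "id_op n \<in> ops n n"
  by (auto simp: ops_iff id_op_def)

lemma id_op_bij [simp]: "id_op n ` {..n} = {..n}" "inj_on (id_op n) {..n}"
  by (auto simp: id_op_def)

lemma compose_order_maps:
  "x \<in> order_maps (ordinal n) P \<Longrightarrow> \<alpha> \<in> ops m n \<Longrightarrow> compose {..m} x \<alpha> \<in> order_maps (ordinal m) P"
  by (auto simp: order_maps_def order_preserving_def PiE_iff Pi_def compose_def)

lemma compose_order_preserving:
  "order_preserving P Q \<phi> \<Longrightarrow> x \<in> order_maps (ordinal n) P \<Longrightarrow>
     compose {..n} \<phi> x \<in> order_maps (ordinal n) Q"
  by (auto simp: order_maps_def order_preserving_def PiE_iff Pi_def compose_def)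

lemma nerve_simps [simp]:
  "smp (nerve P) n = order_maps (ordinal n) P"
  "act (nerve P) n m x \<alpha> = compose {..m} x \<alpha>"
  by (simp_all add: nerve_def)

lemma simplicial_set_nerve: "simplicial_set (nerve P)"
proof
  fix x n assume "x \<in> smp (nerve P) n"
  then show "act (nerve P) n n x (id_op n) = x"
    by (auto simp: order_maps_def PiE_def id_op_def intro: compose_Id)
next
  fix x n \<alpha> m \<beta> k assume "\<alpha> \<in> ops m n" and b: "\<beta> \<in> ops k m"
  then show "act (nerve P) m k (act (nerve P) n m x \<alpha>) \<beta> = act (nerve P) n k x (compose {..k} \<alpha> \<beta>)"
    by (auto simp: compose_def restrict_def fun_eq_iff dest: ops_le)
qed (auto intro: compose_order_maps)

lemma simplicial_map_nerve:
  assumes "order_preserving P Q \<phi>"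
  shows "simplicial_map (nerve P) (nerve Q) (nerve_map \<phi>)"
  using compose_order_preserving[OF assms] by (auto simp: simplicial_map_def nerve_map_def
      compose_def restrict_def fun_eq_iff dest: ops_le)

lemma simplicial_map_closed: "simplicial_map X Y f \<Longrightarrow> x \<in> smp X n \<Longrightarrow> f n x \<in> smp Y n"
  by (auto simp: simplicial_map_def)

lemma simplicial_map_act:
  "simplicial_map X Y f \<Longrightarrow> x \<in> smp X n \<Longrightarrow> \<alpha> \<in> ops m n \<Longrightarrow>
     f m (act X n m x \<alpha>) = act Y n m (f n x) \<alpha>"
  by (auto simp: simplicial_map_def)

lemma std_simplex_simps [simp]:
  "smp (std_simplex n) m = ops m n"
  "act (std_simplex n) m k x \<alpha> = compose {..k} x \<alpha>"
  by (simp_all add: std_simplex_def)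

lemma (in simplicial_set) simplicial_map_repr_map:
  "x \<in> smp X n \<Longrightarrow> simplicial_map (std_simplex n) X (repr_map X n x)"
  by (auto simp: simplicial_map_def repr_map_def act_closed act_comp)

subsubsection \<open>Eilenberg--Zilber\<close>

lemma coface_ops: "i \<le> Suc k \<Longrightarrow> coface k i \<in> ops k (Suc k)"
  by (auto simp: ops_iff coface_def)

text \<open>The surjective operator from \<open>[k + 1]\<close> to \<open>[k]\<close> taking the value \<open>i\<close> twice.\<close>

definition codeg :: "nat \<Rightarrow> nat \<Rightarrow> nat \<Rightarrow> nat" where
  "codeg k i = (\<lambda>j\<in>{..Suc k}. if j \<le> i then j else j - 1)"

lemma codeg_ops: "i \<le> k \<Longrightarrow> codeg k i \<in> ops (Suc k) k"
  by (auto simp: ops_iff codeg_def)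

lemma codeg_surj: "i \<le> k \<Longrightarrow> codeg k i ` {..Suc k} = {..k}"
proof (intro equalityI subsetI)
  fix j assume "i \<le> k" "j \<in> {..k}"
  then show "j \<in> codeg k i ` {..Suc k}"
    by (intro image_eqI[of _ _ "if j \<le> i then j else Suc j"]) (auto simp: codeg_def)
qed (auto simp: codeg_def)

lemma factor_codeg:
  assumes "\<gamma> \<in> order_maps (ordinal (Suc k)) P" "i \<le> k" "\<gamma> i = \<gamma> (Suc i)"
  shows "\<gamma> = compose {..Suc k} (compose {..k} \<gamma> (coface k (Suc i))) (codeg k i)"
proof
  fix j
  consider "j \<le> i" | "j = Suc i" | "Suc i < j" "j \<le> Suc k" | "Suc k < j" by linarith
  then show "\<gamma> j = compose {..Suc k} (compose {..k} \<gamma> (coface k (Suc i))) (codeg k i) j"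
  proof cases
    case 4
    then show ?thesis using assms(1) by (auto simp: compose_def order_maps_def PiE_iff extensional_def)
  qed (use assms in \<open>auto simp: compose_def coface_def codeg_def\<close>)
qed

lemma not_inj_on_atMost:
  fixes f :: "nat \<Rightarrow> 'b"
  assumes "\<not> inj_on f {..m}"
  obtains i j where "i < j" "j \<le> m" "f i = f j"
proof -
  obtain i j where "i \<le> m" "j \<le> m" "f i = f j" "i \<noteq> j"
    using assms unfolding inj_on_def by auto
  then show thesis using that[of i j] that[of j i] by (cases "i < j") auto
qed

lemma ops_not_inj:
  assumes "\<gamma> \<in> ops m n" "\<not> inj_on \<gamma> {..m}"
  obtains k i where "m = Suc k" "i \<le> k" "\<gamma> i = \<gamma> (Suc i)"
proof -
  obtain i j where ij: "i < j" "j \<le> m" "\<gamma> i = \<gamma> j"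
    using not_inj_on_atMost[OF assms(2)] .
  have "\<gamma> i \<le> \<gamma> (Suc i)" "\<gamma> (Suc i) \<le> \<gamma> j"
    using ij(1,2) by (auto intro: ops_mono[OF assms(1)])
  with ij show thesis
    using that[of "m - 1" i] by simp
qed

lemma ops_inj_le:
  assumes "\<gamma> \<in> ops m n" "inj_on \<gamma> {..m}"
  shows "m \<le> n"
proof -
  have "card {..m} \<le> card {..n}"
    using assms by (intro card_inj_on_le[of \<gamma>]) (auto simp: ops_iff PiE_iff)
  then show ?thesis by simp
qed

lemma ops_inj_id:
  assumes "\<gamma> \<in> ops n n" "inj_on \<gamma> {..n}"
  shows "\<gamma> = id_op n"
proof -
  have lt: "\<gamma> i < \<gamma> (Suc i)" if "Suc i \<le> n" for i
  proof (rule le_neq_implies_less)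
    show "\<gamma> i \<le> \<gamma> (Suc i)" using that by (intro ops_mono[OF assms(1)]) auto
    show "\<gamma> i \<noteq> \<gamma> (Suc i)" using inj_onD[OF assms(2), of i "Suc i"] that by auto
  qed
  have lo: "i \<le> n \<Longrightarrow> i \<le> \<gamma> i" for i
  proof (induction i)
    case (Suc i)
    then show ?case using lt[of i] by auto
  qed simp
  have hi: "i \<le> n \<Longrightarrow> \<gamma> (n - i) \<le> n - i" for i
  proof (induction i)
    case 0
    then show ?case using ops_le[OF assms(1)] by simp
  next
    case (Suc i)
    then show ?case using lt[of "n - Suc i"] by (auto simp: Suc_diff_Suc)
  qed
  have "\<gamma> i = i" if "i \<le> n" for i
    using lo[of i] hi[of "n - i"] that by simp
  then show ?thesis
    by (intro ops_ext[OF assms(1) id_op]) (auto simp: id_op_def)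
qed

lemma ops_section:
  assumes "\<sigma> \<in> ops n m" "\<sigma> ` {..n} = {..m}"
  obtains d where "d \<in> ops m n" "inj_on d {..m}" "compose {..m} \<sigma> d = id_op m"
proof -
  define d where "d = (\<lambda>j\<in>{..m}. LEAST i. i \<le> n \<and> \<sigma> i = j)"
  have d: "d j \<le> n \<and> \<sigma> (d j) = j" if "j \<le> m" for j
  proof -
    have "\<exists>i. i \<le> n \<and> \<sigma> i = j"
      using assms(2) that by (metis atMost_iff imageE)
    from LeastI_ex[OF this] show ?thesis using that by (simp add: d_def)
  qed
  have "d i \<le> d j" if "i \<le> j" "j \<le> m" for i j
  proof (rule ccontr)
    assume "\<not> d i \<le> d j"
    then have "\<sigma> (d j) \<le> \<sigma> (d i)"
      using d[of i] that by (intro ops_mono[OF assms(1)]) auto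
    then have "i = j" using d[of i] d[of j] that by auto
    with \<open>\<not> d i \<le> d j\<close> show False by simp
  qed
  moreover have "d \<in> extensional {..m}" by (simp add: d_def)
  ultimately have "d \<in> ops m n" using d by (auto simp: ops_iff PiE_iff)
  moreover have "inj_on d {..m}" using d by (metis atMost_iff inj_onI)
  moreover have "compose {..m} \<sigma> d = id_op m"
    using d by (auto simp: compose_def id_op_def fun_eq_iff)
  ultimately show thesis by (rule that)
qed

lemma nondeg_smp: "x \<in> nondeg X n \<Longrightarrow> x \<in> smp X n"
  by (simp add: nondeg_def)

lemma sharp_poset_iff:
  "((m, y), (n, x)) \<in> sharp_poset X \<longleftrightarrow> y \<in> nondeg X m \<and> x \<in> nondeg X n \<and>
     (\<exists>\<mu>\<in>ops m n. inj_on \<mu> {..m} \<and> y = act X n m x \<mu>)"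
  by (simp add: sharp_poset_def)

lemma compose_ops: "\<alpha> \<in> ops m n \<Longrightarrow> \<beta> \<in> ops k m \<Longrightarrow> compose {..k} \<alpha> \<beta> \<in> ops k n"
  by (rule compose_order_maps)

context simplicial_set
begin

lemma act_codeg_degenerate:
  assumes "w \<in> smp X k" "i \<le> k" shows "act X k (Suc k) w (codeg k i) \<notin> nondeg X (Suc k)"
  using assms codeg_ops[OF assms(2)] codeg_surj[OF assms(2)]
  unfolding nondeg_def by (blast intro: lessI)

lemma nondeg_inj:
  assumes "w \<in> nondeg X m" "v \<in> smp X n" "\<gamma> \<in> ops m n" "w = act X n m v \<gamma>"
  shows "inj_on \<gamma> {..m}"
proof (rule ccontr)
  assume "\<not> inj_on \<gamma> {..m}"
  then obtain k i where i: "m = Suc k" "i \<le> k" "\<gamma> i = \<gamma> (Suc i)"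
    using ops_not_inj[OF assms(3)] by metis
  let ?\<delta> = "compose {..k} \<gamma> (coface k (Suc i))"
  have \<delta>: "?\<delta> \<in> ops k n"
    using assms(3) i by (intro compose_ops[of _ m] coface_ops) (auto intro: coface_ops)
  have "w = act X k (Suc k) (act X n k v ?\<delta>) (codeg k i)"
    using factor_codeg[of \<gamma> k "ordinal n" i] act_comp[OF assms(2) \<delta> codeg_ops[OF i(2)]] assms i by simp
  then show False
    using act_codeg_degenerate[OF act_closed[OF assms(2) \<delta>] i(2)] assms(1) i by simp
qed

lemma eilenberg_zilber:
  assumes "x \<in> smp X n"
  shows "\<exists>!p. \<exists>m w. p = (m, w) \<and> w \<in> nondeg X m \<and>
     (\<exists>\<sigma>\<in>ops n m. \<sigma> ` {..n} = {..m} \<and> x = act X m n w \<sigma>)"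
proof -
  have ex: "\<exists>m w. w \<in> nondeg X m \<and> (\<exists>\<sigma>\<in>ops n m. \<sigma> ` {..n} = {..m} \<and> x = act X m n w \<sigma>)"
    using assms
  proof (induction n arbitrary: x rule: less_induct)
    case (less n)
    show ?case
    proof (cases "x \<in> nondeg X n")
      case True
      then show ?thesis
        using less.prems act_id by (intro exI[of _ n] exI[of _ x] conjI bexI[of _ "id_op n"]) auto
    next
      case False
      then obtain m w \<sigma> where m: "m < n" "w \<in> smp X m" "\<sigma> \<in> ops n m" "\<sigma> ` {..n} = {..m}"
        "x = act X m n w \<sigma>"
        using less.prems by (auto simp: nondeg_def)
      with less.IH[of m w] obtain k v \<tau> where
        v: "v \<in> nondeg X k" "\<tau> \<in> ops m k" "\<tau> ` {..m} = {..k}" "w = act X k m v \<tau>" by metis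
      have "x = act X k n v (compose {..n} \<tau> \<sigma>)"
        using act_comp[OF nondeg_smp[OF v(1)] v(2) m(3)] m v by simp
      moreover have "compose {..n} \<tau> \<sigma> ` {..n} = {..k}"
        using m(4) v(3) by (rule surj_compose)
      ultimately show ?thesis
        using v(1) compose_ops[OF v(2) m(3)] by metis
    qed
  qed
  have face: "\<exists>\<gamma>. \<gamma> \<in> ops m' m \<and> inj_on \<gamma> {..m'} \<and> w' = act X m m' w \<gamma>"
    if w: "w \<in> nondeg X m" "\<sigma> \<in> ops n m" "x = act X m n w \<sigma>"
    and w': "w' \<in> nondeg X m'" "\<sigma>' \<in> ops n m'" "\<sigma>' ` {..n} = {..m'}" "x = act X m' n w' \<sigma>'"
    for m w \<sigma> m' w' \<sigma>'
  proof -
    obtain d where d: "d \<in> ops m' n" "compose {..m'} \<sigma>' d = id_op m'"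
      using ops_section[OF w'(2,3)] by metis
    have "act X n m' x d = w'"
      using act_comp[OF nondeg_smp[OF w'(1)] w'(2) d(1)] act_id[OF nondeg_smp[OF w'(1)]] d w' by simp
    moreover have "act X n m' x d = act X m m' w (compose {..m'} \<sigma> d)"
      using act_comp[OF nondeg_smp[OF w(1)] w(2) d(1)] w by simp
    ultimately show ?thesis
      using nondeg_inj[OF w'(1) nondeg_smp[OF w(1)]] compose_ops[OF w(2) d(1)] by metis
  qed
  show ?thesis
  proof (rule ex_ex1I)
    show "\<exists>p m w. p = (m, w) \<and> w \<in> nondeg X m \<and>
      (\<exists>\<sigma>\<in>ops n m. \<sigma> ` {..n} = {..m} \<and> x = act X m n w \<sigma>)" using ex by blast
  next
    fix p p'
    assume "\<exists>m w. p = (m, w) \<and> w \<in> nondeg X m \<and>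
        (\<exists>\<sigma>\<in>ops n m. \<sigma> ` {..n} = {..m} \<and> x = act X m n w \<sigma>)"
      and "\<exists>m w. p' = (m, w) \<and> w \<in> nondeg X m \<and>
        (\<exists>\<sigma>\<in>ops n m. \<sigma> ` {..n} = {..m} \<and> x = act X m n w \<sigma>)"
    then obtain m w \<sigma> m' w' \<sigma>' where
      w: "p = (m, w)" "w \<in> nondeg X m" "\<sigma> \<in> ops n m" "\<sigma> ` {..n} = {..m}" "x = act X m n w \<sigma>" and
      w': "p' = (m', w')" "w' \<in> nondeg X m'" "\<sigma>' \<in> ops n m'" "\<sigma>' ` {..n} = {..m'}"
          "x = act X m' n w' \<sigma>'" by blast
    obtain \<gamma> where \<gamma>: "\<gamma> \<in> ops m' m" "inj_on \<gamma> {..m'}" "w' = act X m m' w \<gamma>"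
      using face[OF w(2,3,5) w'(2-5)] by blast
    obtain \<gamma>' where "\<gamma>' \<in> ops m m'" "inj_on \<gamma>' {..m}"
      using face[OF w'(2,3,5) w(2-5)] by blast
    with \<gamma> have "m = m'" by (meson ops_inj_le le_antisym)
    with \<gamma> have "\<gamma> = id_op m" by (auto intro: ops_inj_id)
    with \<gamma> \<open>m = m'\<close> have "w' = w" using act_id nondeg_smp[OF w(2)] by simp
    with \<open>m = m'\<close> w w' show "p = p'" by simp
  qed
qed

lemma sharpE:
  assumes "x \<in> smp X n"
  obtains m w \<sigma> where "sharp X n x = (m, w)" "w \<in> nondeg X m" "\<sigma> \<in> ops n m"
    "\<sigma> ` {..n} = {..m}" "x = act X m n w \<sigma>"
  using theI'[OF eilenberg_zilber[OF assms]] by (auto simp: sharp_def)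

lemma Field_sharp_poset: "Field (sharp_poset X) = {(n, x). x \<in> nondeg X n}"
proof -
  have "((n, x), (n, x)) \<in> sharp_poset X" if "x \<in> nondeg X n" for n x
    using that act_id[OF nondeg_smp[OF that]]
    by (auto simp: sharp_poset_def intro!: bexI[of _ "id_op n"])
  then have "{(n, x). x \<in> nondeg X n} \<subseteq> Field (sharp_poset X)"
    by (auto intro: FieldI1)
  moreover have "Field (sharp_poset X) \<subseteq> {(n, x). x \<in> nondeg X n}"
    by (auto simp: Field_def sharp_poset_def)
  ultimately show ?thesis by (rule antisym[rotated])
qed

lemma Partial_order_sharp_poset: "Partial_order (sharp_poset X)"
proof -
  have "refl_on (Field (sharp_poset X)) (sharp_poset X)"
  proof (rule refl_onI, unfold Field_sharp_poset, clarify)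
    fix n x assume "x \<in> nondeg X n"
    then show "((n, x), (n, x)) \<in> sharp_poset X"
      using act_id[OF nondeg_smp]
      by (auto simp: sharp_poset_def intro!: bexI[of _ "id_op n"])
  qed
  moreover have "trans (sharp_poset X)"
  proof (rule transI, clarify)
    fix k z m y n x
    assume "((k, z), (m, y)) \<in> sharp_poset X" "((m, y), (n, x)) \<in> sharp_poset X"
    then obtain \<mu> \<nu> where *: "z \<in> nondeg X k" "x \<in> nondeg X n" "\<nu> \<in> ops k m" "inj_on \<nu> {..k}"
      "z = act X m k y \<nu>" "\<mu> \<in> ops m n" "inj_on \<mu> {..m}" "y = act X n m x \<mu>"
      by (auto simp: sharp_poset_def)
    have "z = act X n k x (compose {..k} \<mu> \<nu>)"
      using * act_comp[OF nondeg_smp] by simp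
    then show "((k, z), (n, x)) \<in> sharp_poset X"
      using * compose_ops[of \<mu> m n \<nu> k] nondeg_inj[of z k x n "compose {..k} \<mu> \<nu>"]
      by (auto simp: sharp_poset_def nondeg_smp)
  qed
  moreover have "antisym (sharp_poset X)"
  proof (rule antisymI, clarify)
    fix m y n x
    assume "((m, y), (n, x)) \<in> sharp_poset X" "((n, x), (m, y)) \<in> sharp_poset X"
    then obtain \<mu> \<nu> where *: "x \<in> nondeg X n" "\<nu> \<in> ops n m" "inj_on \<nu> {..n}"
      "\<mu> \<in> ops m n" "inj_on \<mu> {..m}" "y = act X n m x \<mu>"
      by (auto simp: sharp_poset_def)
    then have mn: "m = n" by (meson ops_inj_le le_antisym)
    with * have "\<mu> = id_op n" by (auto intro: ops_inj_id)
    with * mn act_id[OF nondeg_smp] show "m = n \<and> y = x" by simp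
  qed
  ultimately show ?thesis
    by (auto simp: partial_order_on_def preorder_on_def Field_def)
qed

end

lemma order_preserving_sharp_map:
  assumes "simplicial_set X" "simplicial_set Y" "simplicial_map X Y f"
  shows "order_preserving (sharp_poset X) (sharp_poset Y) (sharp_map Y f)"
proof -
  interpret X: simplicial_set X by fact
  interpret Y: simplicial_set Y by fact
  have "sharp_map Y f (n, x) \<in> Field (sharp_poset Y)" if "x \<in> nondeg X n" for n x
  proof -
    have "f n x \<in> smp Y n" using simplicial_map_closed[OF assms(3)] nondeg_smp[OF that] by blast
    then obtain m w where "sharp Y n (f n x) = (m, w)" "w \<in> nondeg Y m"
      by (rule Y.sharpE)
    then show ?thesis by (simp add: Y.Field_sharp_poset sharp_map_def)
  qed
  moreover have "(sharp_map Y f (m, y), sharp_map Y f (n, x)) \<in> sharp_poset Y"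
    if le: "((m, y), (n, x)) \<in> sharp_poset X" for m y n x
  proof -
    obtain \<mu> where \<mu>: "y \<in> nondeg X m" "x \<in> nondeg X n" "\<mu> \<in> ops m n" "y = act X n m x \<mu>"
      using le unfolding sharp_poset_iff by blast
    have fX: "f n x \<in> smp Y n" "f m y \<in> smp Y m"
      using simplicial_map_closed[OF assms(3) nondeg_smp[OF \<mu>(2)]]
        simplicial_map_closed[OF assms(3) nondeg_smp[OF \<mu>(1)]] .
    obtain k w \<sigma> where w: "sharp Y n (f n x) = (k, w)" "w \<in> nondeg Y k" "\<sigma> \<in> ops n k"
      "f n x = act Y k n w \<sigma>"
      using fX(1) by (rule Y.sharpE)
    obtain l v \<tau> where v: "sharp Y m (f m y) = (l, v)" "v \<in> nondeg Y l" "\<tau> \<in> ops m l"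
      "\<tau> ` {..m} = {..l}" "f m y = act Y l m v \<tau>"
      using fX(2) by (rule Y.sharpE)
    obtain d where d: "d \<in> ops l m" "compose {..l} \<tau> d = id_op l"
      using ops_section[OF v(3,4)] by metis
    have \<sigma>\<mu>: "compose {..m} \<sigma> \<mu> \<in> ops m k" using w(3) \<mu>(3) by (rule compose_ops)
    have \<gamma>: "compose {..l} (compose {..m} \<sigma> \<mu>) d \<in> ops l k" using \<sigma>\<mu> d(1) by (rule compose_ops)
    have fy: "f m y = act Y k m w (compose {..m} \<sigma> \<mu>)"
      unfolding \<mu>(4) simplicial_map_act[OF assms(3) nondeg_smp[OF \<mu>(2)] \<mu>(3)] w(4)
      using Y.act_comp[OF nondeg_smp[OF w(2)] w(3) \<mu>(3)] .
    have "v = act Y m l (f m y) d"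
      unfolding v(5) Y.act_comp[OF nondeg_smp[OF v(2)] v(3) d(1)] d(2)
      by (rule Y.act_id[OF nondeg_smp[OF v(2)], symmetric])
    also have "\<dots> = act Y k l w (compose {..l} (compose {..m} \<sigma> \<mu>) d)"
      using Y.act_comp[OF nondeg_smp[OF w(2)] \<sigma>\<mu> d(1)] fy by simp
    finally show ?thesis
      using v w \<gamma> Y.nondeg_inj[OF v(2) nondeg_smp[OF w(2)] \<gamma>]
      by (auto simp: sharp_poset_def sharp_map_def)
  qed
  ultimately show ?thesis
    by (auto simp: order_preserving_def X.Field_sharp_poset)
qed

lemma nonsingular_nerve:
  assumes "antisym P" shows "nonsingular (nerve P)"
proof -
  interpret simplicial_set "nerve P" by (rule simplicial_set_nerve)
  show ?thesis
    unfolding nonsingular_def degreewise_injective_def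
  proof (intro allI ballI inj_onI)
    fix n x m \<alpha> \<beta>
    assume x: "x \<in> nondeg (nerve P) n" and \<alpha>: "\<alpha> \<in> smp (std_simplex n) m"
      and \<beta>: "\<beta> \<in> smp (std_simplex n) m"
      and eq: "repr_map (nerve P) n x m \<alpha> = repr_map (nerve P) n x m \<beta>"
    have xs: "x \<in> order_maps (ordinal n) P" using nondeg_smp[OF x] by simp
    have inj: "inj_on x {..n}"
    proof (rule ccontr)
      assume "\<not> inj_on x {..n}"
      then obtain i j where ij: "i < j" "j \<le> n" "x i = x j"
        by (rule not_inj_on_atMost)
      obtain k where k: "n = Suc k" using ij by (cases n) auto
      have "(x i, x (Suc i)) \<in> P" "(x (Suc i), x j) \<in> P"
        using xs ij(1,2) by (auto simp: order_maps_def order_preserving_def)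
      with ij(3) have e: "x i = x (Suc i)" by (metis antisymD[OF assms])
      let ?w = "compose {..k} x (coface k (Suc i))"
      have "act (nerve P) k (Suc k) ?w (codeg k i) = x"
        unfolding nerve_simps
        by (rule factor_codeg[symmetric, where P = P]) (use xs e ij k in simp_all)
      moreover have "?w \<in> smp (nerve P) k"
        using xs k ij compose_order_maps[of x n P "coface k (Suc i)" k] coface_ops[of "Suc i" k] by simp
      moreover have "i \<le> k" using ij k by simp
      ultimately show False
        using act_codeg_degenerate[of ?w k i] x k by metis
    qed
    show "\<alpha> = \<beta>"
    proof (rule ops_ext[of _ m n _ n])
      fix i assume i: "i \<le> m"
      then have "x (\<alpha> i) = x (\<beta> i)"
        using fun_cong[OF eq, of i] by (simp add: repr_map_def compose_def)
      moreover have "\<alpha> i \<in> {..n}" "\<beta> i \<in> {..n}" using i \<alpha> \<beta> by (simp_all add: ops_le)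
      ultimately show "\<alpha> i = \<beta> i" using inj by (simp add: inj_on_eq_iff)
    qed (use \<alpha> \<beta> in auto)
  qed
qed

subsubsection \<open>Quotients\<close>

lemma congruence_equiv: "congruence X E \<Longrightarrow> equiv (smp X n) (E n)"
  by (simp add: congruence_def)

lemma congruence_act: "congruence X E \<Longrightarrow> (x, x') \<in> E n \<Longrightarrow> \<alpha> \<in> ops m n \<Longrightarrow>
   (act X n m x \<alpha>, act X n m x' \<alpha>) \<in> E m"
  unfolding congruence_def by blast

lemma act_quot:
  assumes "congruence X E" "x \<in> smp X n" "\<alpha> \<in> ops m n"
  shows "act (quot X E) n m (E n `` {x}) \<alpha> = E m `` {act X n m x \<alpha>}"
  unfolding quot_def sset.simps
proof (rule UN_equiv_class[OF congruence_equiv[OF assms(1)] _ assms(2)])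
  show "(\<lambda>x. E m `` {act X n m x \<alpha>}) respects E n"
    using congruence_act[OF assms(1) _ assms(3)]
      equiv_class_eq[OF congruence_equiv[OF assms(1), of m]]
    unfolding congruent_def by fastforce
qed

lemma smp_quot: "smp (quot X E) n = smp X n // E n"
  by (simp add: quot_def)

lemma simplicial_map_quot_proj: "congruence X E \<Longrightarrow> simplicial_map X (quot X E) (quot_proj E)"
  by (auto simp: simplicial_map_def quot_proj_def act_quot smp_quot quotientI)

lemma (in simplicial_set) simplicial_set_quot:
  assumes "congruence X E" shows "simplicial_set (quot X E)"
proof
  fix c n m \<alpha> assume "c \<in> smp (quot X E) n" "\<alpha> \<in> ops m n"
  then show "act (quot X E) n m c \<alpha> \<in> smp (quot X E) m"
    by (auto simp: smp_quot act_quot[OF assms] intro!: quotientI act_closed elim!: quotientE)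
next
  fix c n assume "c \<in> smp (quot X E) n"
  then show "act (quot X E) n n c (id_op n) = c"
    by (auto simp: smp_quot act_quot[OF assms] act_id elim!: quotientE)
next
  fix c n m \<alpha> k \<beta> assume "c \<in> smp (quot X E) n" "\<alpha> \<in> ops m n" "\<beta> \<in> ops k m"
  then show "act (quot X E) m k (act (quot X E) n m c \<alpha>) \<beta> =
      act (quot X E) n k c (compose {..k} \<alpha> \<beta>)"
    by (auto simp: smp_quot act_quot[OF assms] act_closed act_comp compose_ops elim!: quotientE)
qed

lemma quot_desc_class:
  assumes "equiv (smp X n) (E n)" "x \<in> smp X n" "\<And>x x'. (x, x') \<in> E n \<Longrightarrow> f n x = f n x'"
  shows "quot_desc f n (E n `` {x}) = f n x"
proof -
  have "f n ` (E n `` {x}) = {f n x}"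
  proof (rule equalityI; rule subsetI)
    fix z assume "z \<in> f n ` (E n `` {x})"
    then obtain x' where "(x, x') \<in> E n" "z = f n x'" by blast
    then show "z \<in> {f n x}" using assms(3)[of x x'] by simp
  qed (use equiv_class_self[OF assms(1,2)] in blast)
  then show ?thesis by (simp add: quot_desc_def)
qed

lemma simplicial_map_quot_desc:
  assumes "congruence X E" "simplicial_map X Y f" "\<And>n x x'. (x, x') \<in> E n \<Longrightarrow> f n x = f n x'"
  shows "simplicial_map (quot X E) Y (quot_desc f)"
    and "x \<in> smp X n \<Longrightarrow> quot_desc f n (quot_proj E n x) = f n x"
proof -
  have *: "quot_desc f n (E n `` {x}) = f n x" if "x \<in> smp X n" for n x
    using congruence_equiv[OF assms(1)] that assms(3) by (rule quot_desc_class)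
  then show "x \<in> smp X n \<Longrightarrow> quot_desc f n (quot_proj E n x) = f n x"
    by (simp add: quot_proj_def)
  have cl: "x \<in> smp X n \<Longrightarrow> \<alpha> \<in> ops m n \<Longrightarrow> act X n m x \<alpha> \<in> smp X m" for x n \<alpha> m
    using congruence_act[OF assms(1), of x x n \<alpha> m] congruence_equiv[OF assms(1)]
    by (auto simp: equiv_def refl_on_def)
  show "simplicial_map (quot X E) Y (quot_desc f)"
    using assms(2)
    by (auto simp: simplicial_map_def smp_quot * act_quot[OF assms(1)] cl Pi_iff elim!: quotientE)
qed

subsubsection \<open>Pushouts\<close>

lemma Plus_iff [simp]: "Inl a \<in> A <+> B \<longleftrightarrow> a \<in> A" "Inr b \<in> A <+> B \<longleftrightarrow> b \<in> B"
  by auto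

lemma coprod_simps [simp]:
  "smp (coprod X Y) n = smp X n <+> smp Y n"
  "act (coprod X Y) n m s \<alpha> = map_sum (\<lambda>x. act X n m x \<alpha>) (\<lambda>y. act Y n m y \<alpha>) s"
  by (simp_all add: coprod_def)

lemma simplicial_set_coprod:
  assumes "simplicial_set X" "simplicial_set Y" shows "simplicial_set (coprod X Y)"
  using assms unfolding simplicial_set_def by (auto split: sum.splits)

lemma congruence_glue:
  assumes X: "simplicial_set X" and Y: "simplicial_set Y"
    and f: "simplicial_map A X f" and g: "simplicial_map A Y g" and A: "simplicial_set A"
  shows "congruence (coprod X Y) (glue A X Y f g)"
  unfolding congruence_def
proof (intro conjI allI impI)
  fix n
  let ?S = "smp X n <+> smp Y n" and ?G = "(\<lambda>a. (Inl (f n a), Inr (g n a))) ` smp A n"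
  let ?R = "Id_on ?S \<union> ?G \<union> ?G\<inverse>"
  have "?R \<subseteq> ?S \<times> ?S"
    using f g by (auto simp: simplicial_map_def)
  then have "?R\<^sup>+ \<subseteq> ?S \<times> ?S" by (rule trancl_subset_Sigma)
  moreover have "refl_on ?S (?R\<^sup>+)" by (auto intro!: refl_onI r_into_trancl')
  moreover have "sym (?R\<^sup>+)" by (intro sym_trancl) (auto simp: sym_def)
  ultimately show "equiv (smp (coprod X Y) n) (glue A X Y f g n)"
    by (simp add: glue_def Let_def equiv_def)
next
  fix n m s s' \<alpha> assume s: "(s, s') \<in> glue A X Y f g n" and \<alpha>: "\<alpha> \<in> ops m n"
  interpret X: simplicial_set X by fact
  interpret Y: simplicial_set Y by fact
  interpret A: simplicial_set A by fact
  let ?R = "\<lambda>n. Id_on (smp X n <+> smp Y n) \<union> (\<lambda>a. (Inl (f n a), Inr (g n a))) ` smp A n \<union>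
     ((\<lambda>a. (Inl (f n a), Inr (g n a))) ` smp A n)\<inverse>"
  let ?h = "\<lambda>s. act (coprod X Y) n m s \<alpha>"
  have st: "(?h s, ?h s') \<in> ?R m" if "(s, s') \<in> ?R n" for s s'
    using that \<alpha> simplicial_map_act[OF f _ \<alpha>] simplicial_map_act[OF g _ \<alpha>]
    by (auto simp: X.act_closed Y.act_closed intro!: A.act_closed simp: image_iff)
      (metis A.act_closed)+
  from s have "(s, s') \<in> (?R n)\<^sup>+" by (simp add: glue_def Let_def)
  then have "(?h s, ?h s') \<in> (?R m)\<^sup>+"
  proof (induction rule: trancl_induct)
    case (base t)
    show ?case using st[OF base] by (rule r_into_trancl)
  next
    case (step t t')
    show ?case using step.IH st[OF step.hyps(2)] by (rule trancl_into_trancl)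
  qed
  then show "(?h s, ?h s') \<in> glue A X Y f g m" by (simp add: glue_def Let_def)
qed


lemma smp_pushout_cases:
  assumes "c \<in> smp (pushout A X Y f g) n"
  obtains x where "x \<in> smp X n" "c = glue A X Y f g n `` {Inl x}"
  | y where "y \<in> smp Y n" "c = glue A X Y f g n `` {Inr y}"
  using assms by (auto simp: pushout_def smp_quot elim!: quotientE)

lemma glue_respects:
  assumes uv: "\<And>n a. a \<in> smp A n \<Longrightarrow> u n (f n a) = v n (g n a)"
    and s: "(s, s') \<in> glue A X Y f g n"
  shows "case_sum (u n) (v n) s = case_sum (u n) (v n) s'"
  using s unfolding glue_def Let_def
  by (induction rule: trancl_induct) (auto simp: uv)

text \<open>The universal property of \<open>pushout\<close>.\<close>

lemma pushout_universal:
  fixes Z :: "'d sset"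
  assumes X: "simplicial_set X" and Y: "simplicial_set Y" and A: "simplicial_set A"
    and f: "simplicial_map A X f" and g: "simplicial_map A Y g"
    and u: "simplicial_map X Z u" and v: "simplicial_map Y Z v"
    and uv: "\<And>n a. a \<in> smp A n \<Longrightarrow> u n (f n a) = v n (g n a)"
  defines "Q \<equiv> pushout A X Y f g" and "q \<equiv> quot_proj (glue A X Y f g)"
  shows "simplicial_set Q"
    and "simplicial_map X Q (\<lambda>n x. q n (Inl x))" and "simplicial_map Y Q (\<lambda>n y. q n (Inr y))"
    and "a \<in> smp A n \<Longrightarrow> q n (Inl (f n a)) = q n (Inr (g n a))"
    and "simplicial_map Q Z (pushout_desc u v)"
    and "x \<in> smp X n \<Longrightarrow> pushout_desc u v n (q n (Inl x)) = u n x"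
    and "y \<in> smp Y n \<Longrightarrow> pushout_desc u v n (q n (Inr y)) = v n y"
    and "(\<And>n x. x \<in> smp X n \<Longrightarrow> h n (q n (Inl x)) = u n x) \<Longrightarrow>
      (\<And>n y. y \<in> smp Y n \<Longrightarrow> h n (q n (Inr y)) = v n y) \<Longrightarrow> c \<in> smp Q n \<Longrightarrow>
      h n c = pushout_desc u v n c"
proof -
  interpret S: simplicial_set "coprod X Y" using X Y by (rule simplicial_set_coprod)
  have cong: "congruence (coprod X Y) (glue A X Y f g)"
    using X Y f g A by (rule congruence_glue)
  show "simplicial_set Q" unfolding Q_def pushout_def using cong by (rule S.simplicial_set_quot)
  have proj: "simplicial_map (coprod X Y) Q q"
    unfolding Q_def q_def pushout_def using cong by (rule simplicial_map_quot_proj)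
  show "simplicial_map X Q (\<lambda>n x. q n (Inl x))"
    unfolding simplicial_map_def
  proof (intro conjI allI ballI funcsetI)
    fix n x assume "x \<in> smp X n"
    then show "q n (Inl x) \<in> smp Q n" using simplicial_map_closed[OF proj, of "Inl x" n] by simp
  next
    fix n m x \<alpha> assume "x \<in> smp X n" "\<alpha> \<in> ops m n"
    then show "q m (Inl (act X n m x \<alpha>)) = act Q n m (q n (Inl x)) \<alpha>"
      using simplicial_map_act[OF proj, of "Inl x" n \<alpha> m] by simp
  qed
  show "simplicial_map Y Q (\<lambda>n x. q n (Inr x))"
    unfolding simplicial_map_def
  proof (intro conjI allI ballI funcsetI)
    fix n x assume "x \<in> smp Y n"
    then show "q n (Inr x) \<in> smp Q n" using simplicial_map_closed[OF proj, of "Inr x" n] by simp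
  next
    fix n m x \<alpha> assume "x \<in> smp Y n" "\<alpha> \<in> ops m n"
    then show "q m (Inr (act Y n m x \<alpha>)) = act Q n m (q n (Inr x)) \<alpha>"
      using simplicial_map_act[OF proj, of "Inr x" n \<alpha> m] by simp
  qed
  show "q n (Inl (f n a)) = q n (Inr (g n a))" if "a \<in> smp A n"
    unfolding q_def quot_proj_def
    by (rule equiv_class_eq[OF congruence_equiv[OF cong]])
       (use that in \<open>auto simp: glue_def Let_def\<close>)
  have uv': "simplicial_map (coprod X Y) Z (\<lambda>n. case_sum (u n) (v n))"
    using u v by (auto simp: simplicial_map_def Pi_iff)
  have resp: "case_sum (u n) (v n) s = case_sum (u n) (v n) s'" if "(s, s') \<in> glue A X Y f g n" for n s s'
    using that by (rule glue_respects[rotated]) (rule uv)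
  note desc = simplicial_map_quot_desc[OF cong uv' resp]
  show "simplicial_map Q Z (pushout_desc u v)"
    unfolding Q_def pushout_def pushout_desc_def by (rule desc(1))
  have d: "pushout_desc u v n (q n s) = case_sum (u n) (v n) s" if "s \<in> smp (coprod X Y) n" for s n
    unfolding pushout_desc_def q_def using that by (intro desc(2))
  have l: "pushout_desc u v n (q n (Inl x)) = u n x" if "x \<in> smp X n" for n x
    using d[of "Inl x" n] that by simp
  have r: "pushout_desc u v n (q n (Inr y)) = v n y" if "y \<in> smp Y n" for n y
    using d[of "Inr y" n] that by simp
  show "x \<in> smp X n \<Longrightarrow> pushout_desc u v n (q n (Inl x)) = u n x" by (rule l)
  show "y \<in> smp Y n \<Longrightarrow> pushout_desc u v n (q n (Inr y)) = v n y" by (rule r)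
  assume h: "\<And>n x. x \<in> smp X n \<Longrightarrow> h n (q n (Inl x)) = u n x"
    "\<And>n y. y \<in> smp Y n \<Longrightarrow> h n (q n (Inr y)) = v n y" and c: "c \<in> smp Q n"
  show "h n c = pushout_desc u v n c"
    using c[unfolded Q_def]
  proof (cases rule: smp_pushout_cases)
    case (1 x)
    then show ?thesis using h(1)[of x n] l[of x n] by (simp add: q_def quot_proj_def)
  next
    case (2 y)
    then show ?thesis using h(2)[of y n] r[of y n] by (simp add: q_def quot_proj_def)
  qed
qed

subsubsection \<open>Desingularization\<close>

lemma quot_class_eq_iff:
  "congruence X E \<Longrightarrow> x \<in> smp X n \<Longrightarrow> y \<in> smp X n \<Longrightarrow>
     E n `` {x} = E n `` {y} \<longleftrightarrow> (x, y) \<in> E n"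
  using congruence_equiv[of X E n] by (meson eq_equiv_class_iff)

text \<open>In a non-singular simplicial set, simplices with coinciding faces are degenerate.\<close>

lemma (in simplicial_set) nonsingular_degenerate:
  assumes ns: "nonsingular X" and x: "x \<in> smp X (Suc k)" and \<alpha>: "\<alpha> \<in> ops m (Suc k)"
    and \<beta>: "\<beta> \<in> ops m (Suc k)" and eq: "act X (Suc k) m x \<alpha> = act X (Suc k) m x \<beta>"
    and i: "l \<le> m" "\<alpha> l \<le> i" "i < \<beta> l"
  shows "act X (Suc k) (Suc k) x (compose {..Suc k} (coface k (Suc i)) (codeg k i)) = x"
proof -
  obtain r w \<sigma> where w: "w \<in> nondeg X r" "\<sigma> \<in> ops (Suc k) r" "x = act X r (Suc k) w \<sigma>"
    using x by (rule sharpE)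
  have ws: "w \<in> smp X r" using w(1) by (rule nondeg_smp)
  have ik: "i \<le> k" using i(3) ops_le[OF \<beta> i(1)] by simp
  have "act X r m w (compose {..m} \<sigma> \<alpha>) = act X r m w (compose {..m} \<sigma> \<beta>)"
    using eq unfolding w(3) act_comp[OF ws w(2) \<alpha>] act_comp[OF ws w(2) \<beta>] .
  then have "compose {..m} \<sigma> \<alpha> = compose {..m} \<sigma> \<beta>"
    using ns w(1) compose_ops[OF w(2) \<alpha>] compose_ops[OF w(2) \<beta>]
    unfolding nonsingular_def degreewise_injective_def repr_map_def inj_on_def std_simplex_simps
    by blast
  from fun_cong[OF this, of l] have e: "\<sigma> (\<alpha> l) = \<sigma> (\<beta> l)"
    using i(1) by (simp add: compose_def)
  have "\<sigma> (\<alpha> l) \<le> \<sigma> i" "\<sigma> i \<le> \<sigma> (Suc i)" "\<sigma> (Suc i) \<le> \<sigma> (\<beta> l)"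
    using i ik ops_le[OF \<beta> i(1)] by (auto intro!: ops_mono[OF w(2)])
  with e have e': "\<sigma> i = \<sigma> (Suc i)" by linarith
  have cf: "coface k (Suc i) \<in> ops k (Suc k)" using ik by (simp add: coface_ops)
  have cg: "codeg k i \<in> ops (Suc k) k" using ik by (rule codeg_ops)
  have "compose {..Suc k} \<sigma> (compose {..Suc k} (coface k (Suc i)) (codeg k i)) =
     compose {..Suc k} (compose {..k} \<sigma> (coface k (Suc i))) (codeg k i)"
    by (rule compose_assoc) (use cg in \<open>auto simp: ops_iff PiE_iff\<close>)
  also have "\<dots> = \<sigma>" by (rule factor_codeg[OF w(2) ik e', symmetric])
  finally show ?thesis
    unfolding w(3) act_comp[OF ws w(2) compose_ops[OF cf cg]] by simp
qed

context simplicial_set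
begin

lemma congruence_desing_rel: "congruence X (desing_rel X)"
  unfolding congruence_def
proof (intro conjI allI impI)
  fix n
  have eq: "equiv (smp X n) (E n)" if "congruence X E" for E
    using that by (rule congruence_equiv)
  show "equiv (smp X n) (desing_rel X n)"
  proof (rule equivI)
    show "desing_rel X n \<subseteq> smp X n \<times> smp X n" by (auto simp: desing_rel_def)
    show "refl_on (smp X n) (desing_rel X n)"
      using eq unfolding refl_on_def desing_rel_def equiv_def by blast
    show "sym (desing_rel X n)"
      using eq unfolding sym_def desing_rel_def equiv_def by blast
    show "trans (desing_rel X n)"
    proof (rule transI)
      fix x y z assume *: "(x, y) \<in> desing_rel X n" "(y, z) \<in> desing_rel X n"
      have "(x, z) \<in> E n" if E: "congruence X E" "nonsingular (quot X E)" for E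
        using * E eq[OF E(1)] unfolding desing_rel_def equiv_def trans_def by blast
      with * show "(x, z) \<in> desing_rel X n" by (simp add: desing_rel_def)
    qed
  qed
next
  fix n m x x' \<alpha> assume "(x, x') \<in> desing_rel X n" "\<alpha> \<in> ops m n"
  then show "(act X n m x \<alpha>, act X n m x' \<alpha>) \<in> desing_rel X m"
    by (auto simp: desing_rel_def act_closed congruence_act)
qed

lemma simplicial_set_desing: "simplicial_set (desing X)"
  unfolding desing_def using congruence_desing_rel by (rule simplicial_set_quot)

lemma nonsingular_desing: "nonsingular (desing X)"
proof -
  interpret D: simplicial_set "desing X" by (rule simplicial_set_desing)
  have main: False
    if c: "c \<in> nondeg (desing X) n" and \<alpha>: "\<alpha> \<in> ops m n" and \<beta>: "\<beta> \<in> ops m n"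
    and eq: "act (desing X) n m c \<alpha> = act (desing X) n m c \<beta>" and l: "l \<le> m" "\<alpha> l < \<beta> l"
    for n c m \<alpha> \<beta> l
  proof -
    obtain x where x: "x \<in> smp X n" "c = desing_rel X n `` {x}"
      using nondeg_smp[OF c] by (auto simp: desing_def smp_quot elim: quotientE)
    obtain k where k: "n = Suc k" using l ops_le[OF \<beta> l(1)] by (cases n) auto
    define i where "i = \<alpha> l"
    have ik: "i \<le> k" using l ops_le[OF \<beta> l(1)] k by (simp add: i_def)
    let ?e = "compose {..Suc k} (coface k (Suc i)) (codeg k i)"
    have cf: "coface k (Suc i) \<in> ops k (Suc k)" using ik by (simp add: coface_ops)
    have cg: "codeg k i \<in> ops (Suc k) k" using ik by (rule codeg_ops)
    have e: "?e \<in> ops (Suc k) (Suc k)" using cf cg by (rule compose_ops)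
    have rel: "(act X n m x \<alpha>, act X n m x \<beta>) \<in> desing_rel X m"
      using eq x act_closed[OF x(1) \<alpha>] act_closed[OF x(1) \<beta>]
      by (simp add: desing_def act_quot[OF congruence_desing_rel _ \<alpha>]
          act_quot[OF congruence_desing_rel _ \<beta>] quot_class_eq_iff[OF congruence_desing_rel])
    have "(act X n n x ?e, x) \<in> E n" if E: "congruence X E" "nonsingular (quot X E)" for E
    proof -
      interpret Q: simplicial_set "quot X E" using E(1) by (rule simplicial_set_quot)
      have "(act X n m x \<alpha>, act X n m x \<beta>) \<in> E m" using rel E by (auto simp: desing_rel_def)
      then have "act (quot X E) n m (E n `` {x}) \<alpha> = act (quot X E) n m (E n `` {x}) \<beta>"
        unfolding act_quot[OF E(1) x(1) \<alpha>] act_quot[OF E(1) x(1) \<beta>]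
        by (rule equiv_class_eq[OF congruence_equiv[OF E(1)]])
      moreover have "E n `` {x} \<in> smp (quot X E) n" using x by (simp add: smp_quot quotientI)
      ultimately have "act (quot X E) n n (E n `` {x}) ?e = E n `` {x}"
        unfolding k using Q.nonsingular_degenerate[OF E(2), of "E n `` {x}" k \<alpha> m \<beta> l i] \<alpha> \<beta> l k
        by (simp add: i_def)
      then have "E n `` {act X n n x ?e} = E n `` {x}"
        using act_quot[OF E(1) x(1), of ?e n] e k by simp
      then show ?thesis
        using quot_class_eq_iff[OF E(1)] act_closed[of x n ?e n] x(1) e k by blast
    qed
    then have "(act X n n x ?e, x) \<in> desing_rel X n"
      using x(1) act_closed[of x n ?e n] e k by (simp add: desing_rel_def)
    then have "act (desing X) n n c ?e = c"
      unfolding x(2) desing_def using act_quot[OF congruence_desing_rel x(1), of ?e n] e k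
        equiv_class_eq[OF congruence_equiv[OF congruence_desing_rel]] by simp
    moreover have cs: "c \<in> smp (desing X) (Suc k)" using nondeg_smp[OF c] k by simp
    ultimately have "act (desing X) k (Suc k) (act (desing X) (Suc k) k c (coface k (Suc i))) (codeg k i) = c"
      using D.act_comp[OF cs cf cg] k by simp
    then show False
      using D.act_codeg_degenerate[OF D.act_closed[OF cs cf] ik] c k by simp
  qed
  show ?thesis
    unfolding nonsingular_def degreewise_injective_def std_simplex_simps repr_map_def
  proof (intro allI ballI inj_onI)
    fix n c m \<alpha> \<beta>
    assume *: "c \<in> nondeg (desing X) n" "\<alpha> \<in> ops m n" "\<beta> \<in> ops m n"
      "act (desing X) n m c \<alpha> = act (desing X) n m c \<beta>"
    show "\<alpha> = \<beta>"
    proof (rule ops_ext[OF *(2,3)])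
      fix l assume "l \<le> m"
      then show "\<alpha> l = \<beta> l"
        using main[OF *] main[OF *(1,3,2) *(4)[symmetric]] by (meson linorder_neqE_nat)
    qed
  qed
qed

lemma simplicial_map_desing_unit: "simplicial_map X (desing X) (desing_unit X)"
  unfolding desing_def desing_unit_def using congruence_desing_rel by (rule simplicial_map_quot_proj)

end

lemma congruence_kernel:
  assumes "simplicial_set X" "simplicial_map X Z f"
  shows "congruence X (\<lambda>n. {(x, x'). x \<in> smp X n \<and> x' \<in> smp X n \<and> f n x = f n x'})"
  unfolding congruence_def equiv_def
  using assms simplicial_set.act_closed[OF assms(1)] simplicial_map_act[OF assms(2)]
  by (auto simp: refl_on_def sym_def trans_def)

lemma nonsingular_kernel_quot:
  assumes X: "simplicial_set X" and Z: "simplicial_set Z" and f: "simplicial_map X Z f"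
    and ns: "nonsingular Z"
  shows "nonsingular (quot X (\<lambda>n. {(x, x'). x \<in> smp X n \<and> x' \<in> smp X n \<and> f n x = f n x'}))"
    (is "nonsingular (quot X ?E)")
proof -
  interpret X: simplicial_set X by fact
  interpret Z: simplicial_set Z by fact
  have cong: "congruence X ?E" using X f by (rule congruence_kernel)
  interpret Q: simplicial_set "quot X ?E" using cong by (rule X.simplicial_set_quot)
  have main: False
    if c: "c \<in> nondeg (quot X ?E) n" and \<alpha>: "\<alpha> \<in> ops m n" and \<beta>: "\<beta> \<in> ops m n"
    and eq: "act (quot X ?E) n m c \<alpha> = act (quot X ?E) n m c \<beta>" and l: "l \<le> m" "\<alpha> l < \<beta> l"
    for n c m \<alpha> \<beta> l
  proof -
    obtain x where x: "x \<in> smp X n" "c = ?E n `` {x}"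
      using nondeg_smp[OF c] by (auto simp: smp_quot elim: quotientE)
    obtain k where k: "n = Suc k" using l ops_le[OF \<beta> l(1)] by (cases n) auto
    define i where "i = \<alpha> l"
    have ik: "i \<le> k" using l ops_le[OF \<beta> l(1)] k by (simp add: i_def)
    let ?e = "compose {..Suc k} (coface k (Suc i)) (codeg k i)"
    have cf: "coface k (Suc i) \<in> ops k (Suc k)" using ik by (simp add: coface_ops)
    have cg: "codeg k i \<in> ops (Suc k) k" using ik by (rule codeg_ops)
    have e: "?e \<in> ops (Suc k) (Suc k)" using cf cg by (rule compose_ops)
    have "(act X n m x \<alpha>, act X n m x \<beta>) \<in> ?E m"
      using eq unfolding x(2) act_quot[OF cong x(1) \<alpha>] act_quot[OF cong x(1) \<beta>]
      by (subst (asm) quot_class_eq_iff[OF cong X.act_closed[OF x(1) \<alpha>] X.act_closed[OF x(1) \<beta>]])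
    then have "act Z n m (f n x) \<alpha> = act Z n m (f n x) \<beta>"
      using simplicial_map_act[OF f x(1)] \<alpha> \<beta> by simp
    then have "act Z n n (f n x) ?e = f n x"
      using Z.nonsingular_degenerate[OF ns, of "f n x" k \<alpha> m \<beta> l i] \<alpha> \<beta> l k
        simplicial_map_closed[OF f x(1)] by (simp add: i_def)
    then have "(act X n n x ?e, x) \<in> ?E n"
      using simplicial_map_act[OF f x(1), of ?e n] X.act_closed[OF x(1), of ?e n] e k x(1) by simp
    then have "act (quot X ?E) n n c ?e = c"
      unfolding x(2) using act_quot[OF cong x(1), of ?e n] e k
        equiv_class_eq[OF congruence_equiv[OF cong], of "act X n n x ?e" x n] by simp
    moreover have cs: "c \<in> smp (quot X ?E) (Suc k)" using nondeg_smp[OF c] k by simp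
    ultimately have "act (quot X ?E) k (Suc k) (act (quot X ?E) (Suc k) k c (coface k (Suc i)))
        (codeg k i) = c"
      using Q.act_comp[OF cs cf cg] k by simp
    then show False
      using Q.act_codeg_degenerate[OF Q.act_closed[OF cs cf] ik] c k by simp
  qed
  show ?thesis
    unfolding nonsingular_def degreewise_injective_def std_simplex_simps repr_map_def
  proof (intro allI ballI inj_onI)
    fix n c m \<alpha> \<beta>
    assume *: "c \<in> nondeg (quot X ?E) n" "\<alpha> \<in> ops m n" "\<beta> \<in> ops m n"
      "act (quot X ?E) n m c \<alpha> = act (quot X ?E) n m c \<beta>"
    show "\<alpha> = \<beta>"
    proof (rule ops_ext[OF *(2,3)])
      fix l assume "l \<le> m"
      then show "\<alpha> l = \<beta> l"
        using main[OF *] main[OF *(1,3,2) *(4)[symmetric]] by (meson linorder_neqE_nat)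
    qed
  qed
qed

text \<open>The universal property of \<open>desing\<close>.\<close>

lemma desing_universal:
  fixes Z :: "'d sset"
  assumes X: "simplicial_set X" and Z: "simplicial_set Z" and f: "simplicial_map X Z f"
    and ns: "nonsingular Z"
  shows "simplicial_map (desing X) Z (quot_desc f)"
    and "x \<in> smp X n \<Longrightarrow> quot_desc f n (desing_unit X n x) = f n x"
    and "(\<And>n x. x \<in> smp X n \<Longrightarrow> g n (desing_unit X n x) = f n x) \<Longrightarrow> c \<in> smp (desing X) n \<Longrightarrow>
      g n c = quot_desc f n c"
proof -
  interpret simplicial_set X by fact
  have "f n x = f n x'" if "(x, x') \<in> desing_rel X n" for n x x'
    using that congruence_kernel[OF X f] nonsingular_kernel_quot[OF X Z f ns]
    unfolding desing_rel_def by fastforce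
  note desc = simplicial_map_quot_desc[OF congruence_desing_rel f this]
  show "simplicial_map (desing X) Z (quot_desc f)"
    unfolding desing_def by (rule desc(1))
  show *: "x \<in> smp X n \<Longrightarrow> quot_desc f n (desing_unit X n x) = f n x" for x n
    unfolding desing_unit_def by (rule desc(2))
  assume g: "\<And>n x. x \<in> smp X n \<Longrightarrow> g n (desing_unit X n x) = f n x" and "c \<in> smp (desing X) n"
  then obtain x where "x \<in> smp X n" "c = desing_unit X n x"
    by (auto simp: desing_def smp_quot desing_unit_def quot_proj_def elim: quotientE)
  with g * show "g n c = quot_desc f n c" by simp
qed

subsubsection \<open>Pushouts of posets\<close>

lemma poset_glue_subset:
  assumes "order_preserving A P f" "order_preserving A Q g"
  shows "poset_glue A P Q f g \<subseteq> (Field P <+> Field Q) \<times> (Field P <+> Field Q)"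
  unfolding poset_glue_def Let_def
  by (rule trancl_subset_Sigma)
     (use assms in \<open>auto simp: order_preserving_def Pi_def intro: FieldI1 FieldI2\<close>)

lemma poset_glue_refl:
  assumes "Partial_order P" "Partial_order Q" "s \<in> Field P <+> Field Q"
  shows "(s, s) \<in> poset_glue A P Q f g"
  using assms unfolding poset_glue_def Let_def partial_order_on_def preorder_on_def refl_on_def
  by (auto intro!: r_into_trancl)

lemma trans_poset_glue: "trans (poset_glue A P Q f g)"
  by (simp add: poset_glue_def Let_def)

lemma poset_class_le_iff:
  assumes "Partial_order P" "Partial_order Q" "s \<in> Field P <+> Field Q" "t \<in> Field P <+> Field Q"
  shows "(poset_class A P Q f g s, poset_class A P Q f g t) \<in> poset_pushout A P Q f g \<longleftrightarrow>
     (s, t) \<in> poset_glue A P Q f g" (is "?L \<longleftrightarrow> ?R")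
proof
  assume ?L
  then obtain s' t' where *: "(s', t') \<in> poset_glue A P Q f g"
    "poset_class A P Q f g s = poset_class A P Q f g s'"
    "poset_class A P Q f g t = poset_class A P Q f g t'"
    by (auto simp: poset_pushout_def)
  have "s \<in> poset_class A P Q f g s" "t \<in> poset_class A P Q f g t"
    using poset_glue_refl[OF assms(1-3)] poset_glue_refl[OF assms(1,2,4)]
    by (simp_all add: poset_class_def)
  then have "(s, s') \<in> poset_glue A P Q f g" "(t', t) \<in> poset_glue A P Q f g"
    unfolding *(2,3) by (auto simp: poset_class_def)
  with *(1) show ?R using trans_poset_glue by (meson transE)
qed (auto simp: poset_pushout_def)

lemma Field_poset_pushout:
  assumes "Partial_order P" "Partial_order Q" "order_preserving A P f" "order_preserving A Q g"
  shows "Field (poset_pushout A P Q f g) = poset_class A P Q f g ` (Field P <+> Field Q)"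
proof
  show "Field (poset_pushout A P Q f g) \<subseteq> poset_class A P Q f g ` (Field P <+> Field Q)"
    using poset_glue_subset[OF assms(3,4)] by (fastforce simp: Field_def poset_pushout_def)
  show "poset_class A P Q f g ` (Field P <+> Field Q) \<subseteq> Field (poset_pushout A P Q f g)"
    using poset_class_le_iff[OF assms(1,2)] poset_glue_refl[OF assms(1,2)] by (blast intro: FieldI1)
qed

lemma Partial_order_poset_pushout:
  assumes "Partial_order P" "Partial_order Q" "order_preserving A P f" "order_preserving A Q g"
  shows "Partial_order (poset_pushout A P Q f g)"
proof -
  let ?c = "poset_class A P Q f g" and ?R = "poset_pushout A P Q f g"
  note F = Field_poset_pushout[OF assms] and le = poset_class_le_iff[OF assms(1,2)]
  have elem: "\<exists>s\<in>Field P <+> Field Q. a = ?c s" if "a \<in> Field ?R" for a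
    using that unfolding F by blast
  have "refl_on (Field ?R) ?R"
    unfolding F by (auto intro!: refl_onI simp: le poset_glue_refl[OF assms(1,2)])
  moreover have "trans ?R"
  proof (rule transI)
    fix a b c assume *: "(a, b) \<in> ?R" "(b, c) \<in> ?R"
    then obtain s t r where "s \<in> Field P <+> Field Q" "a = ?c s" "t \<in> Field P <+> Field Q" "b = ?c t"
      "r \<in> Field P <+> Field Q" "c = ?c r"
      using elem by (meson FieldI1 FieldI2)
    with * le trans_poset_glue show "(a, c) \<in> ?R" by (meson transE)
  qed
  moreover have "antisym ?R"
  proof (rule antisymI)
    fix a b assume *: "(a, b) \<in> ?R" "(b, a) \<in> ?R"
    then obtain s t where st: "s \<in> Field P <+> Field Q" "a = ?c s" "t \<in> Field P <+> Field Q" "b = ?c t"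
      using elem by (meson FieldI1 FieldI2)
    with * le have "(s, t) \<in> poset_glue A P Q f g" "(t, s) \<in> poset_glue A P Q f g" by blast+
    then show "a = b"
      unfolding st poset_class_def using transD[OF trans_poset_glue[of A P Q f g]] by blast
  qed
  ultimately show ?thesis
    by (auto simp: partial_order_on_def preorder_on_def Field_def)
qed

text \<open>The universal property of \<open>poset_pushout\<close>.\<close>

lemma poset_pushout_universal:
  fixes Z :: "'d rel"
  assumes P: "Partial_order P" and Q: "Partial_order Q"
    and f: "order_preserving A P f" and g: "order_preserving A Q g"
    and Z: "Partial_order Z"
    and u: "order_preserving P Z u" and v: "order_preserving Q Z v"
    and uv: "\<And>a. a \<in> Field A \<Longrightarrow> u (f a) = v (g a)"
  defines "S \<equiv> poset_pushout A P Q f g" and "j \<equiv> poset_class A P Q f g"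
  shows "order_preserving P S (\<lambda>p. j (Inl p))" and "order_preserving Q S (\<lambda>q. j (Inr q))"
    and "a \<in> Field A \<Longrightarrow> j (Inl (f a)) = j (Inr (g a))"
    and "\<exists>h. order_preserving S Z h \<and> (\<forall>p\<in>Field P. h (j (Inl p)) = u p) \<and>
       (\<forall>q\<in>Field Q. h (j (Inr q)) = v q) \<and>
       (\<forall>h'. (\<forall>p\<in>Field P. h' (j (Inl p)) = u p) \<and> (\<forall>q\<in>Field Q. h' (j (Inr q)) = v q) \<longrightarrow>
         (\<forall>c\<in>Field S. h' c = h c))"
proof -
  let ?G = "poset_glue A P Q f g"
  note F = Field_poset_pushout[OF P Q f g, folded S_def j_def]
  note le = poset_class_le_iff[OF P Q, of _ _ A f g, folded S_def j_def]
  have "(Inl p, Inl p') \<in> ?G" if "(p, p') \<in> P" for p p'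
    using that unfolding poset_glue_def Let_def by (intro r_into_trancl) auto
  then show "order_preserving P S (\<lambda>p. j (Inl p))"
    by (auto simp: order_preserving_def F le FieldI1 FieldI2)
  have "(Inr q, Inr q') \<in> ?G" if "(q, q') \<in> Q" for q q'
    using that unfolding poset_glue_def Let_def by (intro r_into_trancl) auto
  then show "order_preserving Q S (\<lambda>q. j (Inr q))"
    by (auto simp: order_preserving_def F le FieldI1 FieldI2)
  show "j (Inl (f a)) = j (Inr (g a))" if a: "a \<in> Field A"
  proof -
    have "(Inl (f a), Inr (g a)) \<in> ?G" "(Inr (g a), Inl (f a)) \<in> ?G"
      using a unfolding poset_glue_def Let_def by (auto intro!: r_into_trancl)
    then show ?thesis
      unfolding j_def poset_class_def using transD[OF trans_poset_glue[of A P Q f g]] by blast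
  qed
  let ?w = "case_sum u v"
  have Zr: "(z, z) \<in> Z" if "z \<in> Field Z" for z
    using Z that by (auto simp: partial_order_on_def preorder_on_def refl_on_def)
  have Zt: "trans Z" and Za: "antisym Z"
    using Z by (auto simp: partial_order_on_def preorder_on_def)
  have ua: "u (f a) \<in> Field Z" if "a \<in> Field A" for a
    using that f u by (auto simp: order_preserving_def)
  have st: "(?w s, ?w t) \<in> Z" if "(s, t) \<in> map_prod Inl Inl ` P \<union> map_prod Inr Inr ` Q \<union>
      (\<lambda>a. (Inl (f a), Inr (g a))) ` Field A \<union> ((\<lambda>a. (Inl (f a), Inr (g a))) ` Field A)\<inverse>" for s t
    using that u v uv Zr ua by (auto simp: order_preserving_def)
  have mono: "(?w s, ?w t) \<in> Z" if "(s, t) \<in> ?G" for s t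
    using that unfolding poset_glue_def Let_def
  proof (induction rule: trancl_induct)
    case (base t)
    show ?case using base by (rule st)
  next
    case (step t t')
    show ?case using Zt step.IH st[OF step.hyps(2)] by (rule transD)
  qed
  define h where "h c = ?w (SOME s. s \<in> Field P <+> Field Q \<and> c = j s)" for c
  have h: "h (j s) = ?w s" if s: "s \<in> Field P <+> Field Q" for s
  proof -
    let ?t = "SOME t. t \<in> Field P <+> Field Q \<and> j s = j t"
    have t: "?t \<in> Field P <+> Field Q \<and> j s = j ?t"
      by (rule someI[of _ s]) (use s in simp)
    have "(s, s) \<in> ?G" using poset_glue_refl[OF P Q s] .
    with le[OF s s] t le[of s ?t] le[of ?t s] s have "(s, ?t) \<in> ?G" "(?t, s) \<in> ?G" by metis+
    then show ?thesis
      unfolding h_def using mono antisymD[OF Za] by blast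
  qed
  have "order_preserving S Z h"
    unfolding order_preserving_def
  proof (intro conjI allI impI funcsetI)
    fix c assume "c \<in> Field S"
    then show "h c \<in> Field Z"
      using u v by (auto simp: F h order_preserving_def)
  next
    fix c d assume cd: "(c, d) \<in> S"
    then have "c \<in> Field S" "d \<in> Field S" by (auto intro: FieldI1 FieldI2)
    then obtain s t where "s \<in> Field P <+> Field Q" "c = j s" "t \<in> Field P <+> Field Q" "d = j t"
      unfolding F by blast
    with cd le h mono show "(h c, h d) \<in> Z" by metis
  qed
  then show "\<exists>h. order_preserving S Z h \<and> (\<forall>p\<in>Field P. h (j (Inl p)) = u p) \<and>
       (\<forall>q\<in>Field Q. h (j (Inr q)) = v q) \<and>
       (\<forall>h'. (\<forall>p\<in>Field P. h' (j (Inl p)) = u p) \<and> (\<forall>q\<in>Field Q. h' (j (Inr q)) = v q) \<longrightarrow>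
         (\<forall>c\<in>Field S. h' c = h c))"
    by (intro exI[of _ h]) (auto simp: h F)
qed

subsubsection \<open>The cylinder reduction map\<close>

lemma Field_prod_order:
  "Partial_order P \<Longrightarrow> Partial_order Q \<Longrightarrow> Field (prod_order P Q) = Field P \<times> Field Q"
  unfolding partial_order_on_def preorder_on_def refl_on_def prod_order_def Field_def by fast

lemma Partial_order_prod_order:
  assumes "Partial_order P" "Partial_order Q" shows "Partial_order (prod_order P Q)"
proof -
  have "refl_on (Field (prod_order P Q)) (prod_order P Q)"
    unfolding Field_prod_order[OF assms] using assms
    by (auto simp: refl_on_def prod_order_def partial_order_on_def preorder_on_def)
  moreover have "trans (prod_order P Q)" "antisym (prod_order P Q)"
    using assms unfolding partial_order_on_def preorder_on_def trans_def antisym_def prod_order_def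
    by fastforce+
  ultimately show ?thesis
    by (auto simp: partial_order_on_def preorder_on_def Field_def)
qed

lemma Partial_order_ordinal: "Partial_order (ordinal n)"
  by (auto simp: partial_order_on_def preorder_on_def refl_on_def trans_def antisym_def Field_def)

lemma cr_dcr:
  fixes P :: "'p rel" and R :: "'r rel"
  assumes P: "Partial_order P" and R: "Partial_order R" and \<phi>: "order_preserving P R \<phi>"
  shows simplicial_set_top_cylinder: "simplicial_set (top_cylinder P R \<phi>)"
    and simplicial_set_red_cylinder: "simplicial_set (red_cylinder P R \<phi>)"
    and simplicial_map_cr: "simplicial_map (top_cylinder P R \<phi>) (red_cylinder P R \<phi>) (cr P R \<phi>)"
    and nonsingular_red_cylinder: "nonsingular (red_cylinder P R \<phi>)"
    and simplicial_map_dcr: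
      "simplicial_map (desing (top_cylinder P R \<phi>)) (red_cylinder P R \<phi>) (dcr P R \<phi>)"
    and dcr_unit: "x \<in> smp (top_cylinder P R \<phi>) n \<Longrightarrow>
      dcr P R \<phi> n (desing_unit (top_cylinder P R \<phi>) n x) = cr P R \<phi> n x"
    and dcr_unique: "(\<And>n x. x \<in> smp (top_cylinder P R \<phi>) n \<Longrightarrow>
        g n (desing_unit (top_cylinder P R \<phi>) n x) = cr P R \<phi> n x) \<Longrightarrow>
      c \<in> smp (desing (top_cylinder P R \<phi>)) n \<Longrightarrow> g n c = dcr P R \<phi> n c"
proof -
  let ?C = "prod_order P (ordinal 1)" and ?i = "\<lambda>p. (p, 0::nat)"
  let ?S = "poset_pushout P ?C R ?i \<phi>" and ?j = "poset_class P ?C R ?i \<phi>"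
  have C: "Partial_order ?C" using P Partial_order_ordinal by (rule Partial_order_prod_order)
  have FC: "Field ?C = Field P \<times> {..1}"
    using Field_prod_order[OF P Partial_order_ordinal[of 1]] by simp
  have i: "order_preserving P ?C ?i"
    unfolding order_preserving_def FC by (auto simp: prod_order_def)
  have S: "Partial_order ?S" using C R i \<phi> by (rule Partial_order_poset_pushout)
  \<comment> \<open>only the structure maps of the pushout matter here, so the target is a dummy poset\<close>
  have triv: "Partial_order {((), ())}" "order_preserving ?C {((), ())} (\<lambda>_. ())"
    "order_preserving R {((), ())} (\<lambda>_. ())"
    by (auto simp: partial_order_on_def preorder_on_def refl_on_def trans_def antisym_def Field_def
        order_preserving_def)
  note univ = poset_pushout_universal[OF C R i \<phi> triv]
  have jl: "order_preserving ?C ?S (\<lambda>s. ?j (Inl s))" by (rule univ(1)) simp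
  have jr: "order_preserving R ?S (\<lambda>r. ?j (Inr r))" by (rule univ(2)) simp
  have jeq: "?j (Inl (?i a)) = ?j (Inr (\<phi> a))" if "a \<in> Field P" for a
    by (rule univ(3)) (use that in simp_all)
  have comm: "nerve_map (\<lambda>s. ?j (Inl s)) n (nerve_map ?i n a) =
      nerve_map (\<lambda>r. ?j (Inr r)) n (nerve_map \<phi> n a)" if "a \<in> smp (nerve P) n" for n a
    using that jeq
    by (auto simp: nerve_map_def compose_def restrict_def fun_eq_iff order_maps_def PiE_iff)
  note push = pushout_universal[OF simplicial_set_nerve simplicial_set_nerve simplicial_set_nerve
      simplicial_map_nerve[OF i] simplicial_map_nerve[OF \<phi>] simplicial_map_nerve[OF jl]
      simplicial_map_nerve[OF jr]]
  show T: "simplicial_set (top_cylinder P R \<phi>)"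
    unfolding top_cylinder_def by (rule push(1)) (rule comm)
  show M: "simplicial_set (red_cylinder P R \<phi>)"
    unfolding red_cylinder_def by (rule simplicial_set_nerve)
  show cr: "simplicial_map (top_cylinder P R \<phi>) (red_cylinder P R \<phi>) (cr P R \<phi>)"
    unfolding top_cylinder_def red_cylinder_def cr_def Let_def by (rule push(5)) (rule comm)
  show ns: "nonsingular (red_cylinder P R \<phi>)"
    unfolding red_cylinder_def
    by (rule nonsingular_nerve) (use S in \<open>simp add: partial_order_on_def\<close>)
  note D = desing_universal[OF T M cr ns, folded dcr_def]
  show "simplicial_map (desing (top_cylinder P R \<phi>)) (red_cylinder P R \<phi>) (dcr P R \<phi>)"
    by (rule D(1))
  show "x \<in> smp (top_cylinder P R \<phi>) n \<Longrightarrow>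
      dcr P R \<phi> n (desing_unit (top_cylinder P R \<phi>) n x) = cr P R \<phi> n x"
    by (rule D(2))
  show "(\<And>n x. x \<in> smp (top_cylinder P R \<phi>) n \<Longrightarrow>
        g n (desing_unit (top_cylinder P R \<phi>) n x) = cr P R \<phi> n x) \<Longrightarrow>
      c \<in> smp (desing (top_cylinder P R \<phi>)) n \<Longrightarrow> g n c = dcr P R \<phi> n c"
    by (rule D(3))
qed

end

theory Submission
  imports Defs
begin

text \<open>
  Bijectivity of \<open>dcr\<close> needs two properties of \<open>\<phi> : P \<rightarrow> R\<close>. If every
  \<open>r \<le> \<phi> p\<close> is \<open>\<phi> q\<close> for some \<open>q \<le> p\<close>, then chains of the reduced cylinder lift to
  \<open>P \<times> [1]\<close>, so \<open>dcr\<close> is onto. If moreover any two \<open>q, q' \<le> p\<close> with equal image lie below some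
  \<open>m \<le> p\<close> with that same image, then \<open>dcr\<close> is injective: two lifts of a chain become equal when
  their entries are replaced, from the top downwards, by such common upper bounds \<open>m\<close>. Replacing
  \<open>q\<close> by \<open>m\<close> is harmless in a non-singular quotient, as a simplex having \<open>q\<close> and \<open>m\<close> as
  adjacent, equal vertices is degenerate there.

  For the map induced by a simplex \<open>x\<close> of a regular simplicial set, the second property follows by
  induction on the dimension. One may replace \<open>x\<close> by its non-degenerate part; then a face containing
  the last vertex is determined by its image, and faces avoiding it are faces of \<open>x\<delta>\<^sub>n\<close>.
\<close>

section \<open>Degreewise bijective simplicial maps, and chains in a poset\<close>

lemma simplicial_iso_bij:
  assumes "simplicial_set X" and f: "simplicial_map X Y f"
    and bij: "\<And>n. bij_betw (f n) (smp X n) (smp Y n)"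
  shows "simplicial_iso X Y f"
proof -
  interpret simplicial_set X by fact
  let ?g = "\<lambda>n. inv_into (smp X n) (f n)"
  have g: "?g n z \<in> smp X n" "f n (?g n z) = z" if "z \<in> smp Y n" for n z
    using that bij[of n] by (auto simp: bij_betw_def inv_into_into f_inv_into_f)
  have gf: "?g n (f n x) = x" if "x \<in> smp X n" for n x
    using that bij[of n] by (auto simp: bij_betw_def)
  have "simplicial_map Y X ?g"
    unfolding simplicial_map_def
  proof (intro conjI allI ballI funcsetI)
    fix n m z \<alpha> assume z: "z \<in> smp Y n" and \<alpha>: "\<alpha> \<in> ops m n"
    \<comment> \<open>Compatibility of the inverse with operators is checked after applying
      \<open>f m\<close>, which is injective.\<close>
    have "f m (act X n m (?g n z) \<alpha>) = act Y n m z \<alpha>"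
      using simplicial_map_act[OF f g(1)[OF z] \<alpha>] g(2)[OF z] by simp
    then show "?g m (act Y n m z \<alpha>) = act X n m (?g n z) \<alpha>"
      using gf[OF act_closed[OF g(1)[OF z] \<alpha>]] by simp
  qed (rule g)
  with f g gf show ?thesis unfolding simplicial_iso_def by blast
qed

text \<open>Values lie in the field because the case \<open>k = l\<close> supplies reflexive
  pairs.\<close>

lemma order_maps_ordinalI:
  assumes "w \<in> extensional {..n}" "\<And>k l. k \<le> l \<Longrightarrow> l \<le> n \<Longrightarrow> (w k, w l) \<in> Q"
  shows "w \<in> order_maps (ordinal n) Q"
proof -
  have "w k \<in> Field Q" if "k \<le> n" for k using assms(2)[of k k] that by (auto intro: FieldI1)
  with assms show ?thesis by (auto simp: order_maps_def order_preserving_def PiE_iff)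
qed

lemma order_maps_ordinalD:
  assumes "w \<in> order_maps (ordinal n) Q"
  shows "k \<le> l \<Longrightarrow> l \<le> n \<Longrightarrow> (w k, w l) \<in> Q" and "k \<le> n \<Longrightarrow> w k \<in> Field Q"
    and "w \<in> extensional {..n}"
  using assms by (auto simp: order_maps_def order_preserving_def PiE_iff)

lemma order_maps_ordinal_ext:
  assumes "a \<in> order_maps (ordinal n) Q" "b \<in> order_maps (ordinal n) Q'"
    "\<And>k. k \<le> n \<Longrightarrow> a k = b k"
  shows "a = b"
  using assms by (intro extensionalityI[where A = "{..n}"]) (auto dest: order_maps_ordinalD(3))

subsection \<open>Simplices with coinciding adjacent vertices\<close>

definition vertex_op :: "nat \<Rightarrow> nat \<Rightarrow> nat" where
  "vertex_op j = (\<lambda>i\<in>{..0}. j)"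

lemma vertex_op: "j \<le> n \<Longrightarrow> vertex_op j \<in> ops 0 n"
  by (auto simp: ops_iff vertex_op_def)

lemma codeg_coface: "i \<le> k \<Longrightarrow> compose {..k} (codeg k i) (coface k i) = id_op k"
  by (auto simp: compose_def codeg_def coface_def id_op_def fun_eq_iff)

text \<open>By \<open>nonsingular_degenerate\<close>, equal adjacent vertices make \<open>x\<close>
  the degeneracy along \<open>codeg k j\<close> of its face omitting \<open>Suc j\<close>. As
  \<open>coface k j\<close> is a section of \<open>codeg k j\<close>, the face omitting
  \<open>j\<close> is that same face.\<close>

lemma (in simplicial_set) nonsingular_adjacent_faces:
  assumes ns: "nonsingular X" and x: "x \<in> smp X (Suc k)" and j: "j \<le> k"
    and eq: "act X (Suc k) 0 x (vertex_op j) = act X (Suc k) 0 x (vertex_op (Suc j))"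
  shows "act X (Suc k) k x (coface k j) = act X (Suc k) k x (coface k (Suc j))"
proof -
  have d: "coface k j \<in> ops k (Suc k)" "coface k (Suc j) \<in> ops k (Suc k)"
    using j by (auto intro: coface_ops)
  have s: "codeg k j \<in> ops (Suc k) k" using j by (rule codeg_ops)
  have e: "act X (Suc k) (Suc k) x (compose {..Suc k} (coface k (Suc j)) (codeg k j)) = x"
    by (rule nonsingular_degenerate[OF ns x vertex_op vertex_op eq, of 0])
      (use j in \<open>auto simp: vertex_op_def\<close>)
  let ?f = "act X (Suc k) k x (coface k (Suc j))"
  have f: "?f \<in> smp X k" using x d(2) by (rule act_closed)
  have "act X (Suc k) k x (coface k j) = act X (Suc k) k (act X k (Suc k) ?f (codeg k j)) (coface k j)"
    using e act_comp[OF x d(2) s] by simp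
  also have "\<dots> = act X k k ?f (compose {..k} (codeg k j) (coface k j))"
    using act_comp[OF f s d(1)] .
  also have "\<dots> = ?f" unfolding codeg_coface[OF j] using f by (rule act_id)
  finally show ?thesis .
qed

subsection \<open>The reduced mapping cylinder\<close>

locale cylinder =
  fixes P :: "'p rel" and R :: "'r rel" and \<phi> :: "'p \<Rightarrow> 'r"
  assumes P: "Partial_order P" and R: "Partial_order R" and \<phi>: "order_preserving P R \<phi>"
begin

text \<open>Keeps the upper level written \<open>1\<close>, as in \<open>ordinal 1\<close> and
  \<open>(p, 1)\<close>; the simplifier would turn it into \<open>Suc 0\<close>.\<close>

declare One_nat_def [simp del]

abbreviation "C \<equiv> prod_order P (ordinal 1)"
abbreviation "glue_le \<equiv> poset_glue P C R (\<lambda>p. (p, 0)) \<phi>"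
abbreviation "cls \<equiv> poset_class P C R (\<lambda>p. (p, 0)) \<phi>"
abbreviation "S \<equiv> poset_pushout P C R (\<lambda>p. (p, 0)) \<phi>"
abbreviation "T \<equiv> top_cylinder P R \<phi>"

text \<open>Points of the reduced cylinder are represented by \<open>P + R\<close>, where \<open>Inl p\<close> stands for the
  class of \<open>(p, 1)\<close>.\<close>

fun normal_form :: "'p \<times> nat + 'r \<Rightarrow> 'p + 'r" where
  "normal_form (Inl (p, i)) = (if i = 0 then Inr (\<phi> p) else Inl p)"
| "normal_form (Inr r) = Inr r"

text \<open>The order of the reduced cylinder without a transitive closure: comparing
  \<open>r\<close> with \<open>(p, 1)\<close> amounts to comparing it with \<open>\<phi> p\<close>,
  the class of \<open>(p, 0)\<close>.\<close>

fun cyl_le :: "'p + 'r \<Rightarrow> 'p + 'r \<Rightarrow> bool" where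
  "cyl_le (Inl p) (Inl p') \<longleftrightarrow> (p, p') \<in> P"
| "cyl_le (Inr r) (Inl p) \<longleftrightarrow> (r, \<phi> p) \<in> R"
| "cyl_le (Inr r) (Inr r') \<longleftrightarrow> (r, r') \<in> R"
| "cyl_le (Inl p) (Inr r) \<longleftrightarrow> False"

lemma P_trans: "(p, q) \<in> P \<Longrightarrow> (q, r) \<in> P \<Longrightarrow> (p, r) \<in> P"
  using P unfolding partial_order_on_def preorder_on_def by (meson transD)

lemma R_trans: "(p, q) \<in> R \<Longrightarrow> (q, r) \<in> R \<Longrightarrow> (p, r) \<in> R"
  using R unfolding partial_order_on_def preorder_on_def by (meson transD)

lemma P_antisym: "(p, q) \<in> P \<Longrightarrow> (q, p) \<in> P \<Longrightarrow> p = q"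
  using P unfolding partial_order_on_def by (meson antisymD)

lemma R_antisym: "(p, q) \<in> R \<Longrightarrow> (q, p) \<in> R \<Longrightarrow> p = q"
  using R unfolding partial_order_on_def by (meson antisymD)

lemma P_refl: "p \<in> Field P \<Longrightarrow> (p, p) \<in> P"
  using P unfolding partial_order_on_def preorder_on_def refl_on_def by blast

lemma R_refl: "p \<in> Field R \<Longrightarrow> (p, p) \<in> R"
  using R unfolding partial_order_on_def preorder_on_def refl_on_def by blast

lemma \<phi>_mono: "(p, q) \<in> P \<Longrightarrow> (\<phi> p, \<phi> q) \<in> R"
  using \<phi> by (auto simp: order_preserving_def)

lemma \<phi>_Field: "p \<in> Field P \<Longrightarrow> \<phi> p \<in> Field R"
  using \<phi> by (auto simp: order_preserving_def)

lemma C: "Partial_order C"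
  using P Partial_order_ordinal by (rule Partial_order_prod_order)

lemma Field_C: "Field C = Field P \<times> {..1}"
  using Field_prod_order[OF P Partial_order_ordinal[of 1]] by simp

lemma C_iff: "(s, t) \<in> C \<longleftrightarrow> (fst s, fst t) \<in> P \<and> snd s \<le> snd t \<and> snd t \<le> 1"
  by (auto simp: prod_order_def)

lemma incl: "order_preserving P C (\<lambda>p. (p, 0))"
  unfolding order_preserving_def Field_C by (auto simp: prod_order_def)

lemma cyl_le_trans: "cyl_le u v \<Longrightarrow> cyl_le v w \<Longrightarrow> cyl_le u w"
  by (cases u; cases v; cases w) (auto intro: P_trans R_trans \<phi>_mono)

lemma cyl_le_antisym: "cyl_le u v \<Longrightarrow> cyl_le v u \<Longrightarrow> u = v"
  by (cases u; cases v) (auto intro: P_antisym R_antisym)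

text \<open>Every generating pair of the closure is respected, since \<open>(p, 0)\<close> and
  \<open>\<phi> p\<close> have the same normal form and \<open>\<phi>\<close> is monotone;
  transitivity of \<open>cyl_le\<close> does the rest.\<close>

lemma cyl_le_normal_form: "(s, t) \<in> glue_le \<Longrightarrow> cyl_le (normal_form s) (normal_form t)"
  unfolding poset_glue_def Let_def
proof (induction rule: trancl_induct)
  case (base t)
  then show ?case
    by (auto simp: prod_order_def intro!: \<phi>_mono R_refl \<phi>_Field)
next
  case (step t t')
  from step.hyps(2) have "cyl_le (normal_form t) (normal_form t')"
    by (auto simp: prod_order_def intro!: \<phi>_mono R_refl \<phi>_Field)
  with step.IH show ?case by (rule cyl_le_trans)
qed

lemma S_normal_form:
  assumes "(cls s, cls t) \<in> S" "s \<in> Field C <+> Field R" "t \<in> Field C <+> Field R"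
  shows "cyl_le (normal_form s) (normal_form t)"
  using assms by (simp add: poset_class_le_iff[OF C R] cyl_le_normal_form)

text \<open>Equal classes give inequalities between the normal forms in both directions. This tells
  points of the reduced cylinder apart.\<close>

lemma cls_normal_form:
  assumes "cls s = cls t" "s \<in> Field C <+> Field R" "t \<in> Field C <+> Field R"
  shows "normal_form s = normal_form t"
proof -
  have "(cls s, cls s) \<in> S" "(cls t, cls t) \<in> S"
    using poset_glue_refl[OF C R assms(2)] poset_glue_refl[OF C R assms(3)] assms(2,3)
    by (simp_all only: poset_class_le_iff[OF C R])
  with assms show ?thesis by (intro cyl_le_antisym S_normal_form) auto
qed

lemma cls_glue:
  assumes "p \<in> Field P" shows "cls (Inl (p, 0)) = cls (Inr (\<phi> p))"
proof -
  have "(Inl (p, 0), Inr (\<phi> p)) \<in> glue_le" "(Inr (\<phi> p), Inl (p, 0)) \<in> glue_le"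
    using assms unfolding poset_glue_def Let_def by (auto intro!: r_into_trancl)
  then show ?thesis
    unfolding poset_class_def using transD[OF trans_poset_glue] by blast
qed

text \<open>The gluing moves a point at level 0 into \<open>R\<close>, so level 1 and
  \<open>R\<close> account for all classes.\<close>

lemma S_elem:
  assumes "c \<in> Field S"
  obtains p where "p \<in> Field P" "c = cls (Inl (p, 1))" | r where "r \<in> Field R" "c = cls (Inr r)"
proof -
  obtain s where s: "s \<in> Field C <+> Field R" "c = cls s"
    using assms unfolding Field_poset_pushout[OF C R incl \<phi>] by blast
  show thesis
  proof (cases s)
    case (Inl a)
    then obtain p i where "s = Inl (p, i)" "p \<in> Field P" "i \<le> 1" using s by (auto simp: Field_C)
    then show thesis
      using s(2) that(1)[of p] that(2)[of "\<phi> p"] cls_glue[of p] \<phi>_Field[of p]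
      by (cases "i = 0") (auto simp: le_eq_less_or_eq)
  qed (use s that in auto)
qed

subsection \<open>Simplices of the topological mapping cylinder\<close>

abbreviation proj where "proj \<equiv> quot_proj (glue (nerve P) (nerve C) (nerve R) (nerve_map (\<lambda>p. (p, 0))) (nerve_map \<phi>))"

lemma cls_order_preserving:
  "order_preserving C S (\<lambda>s. cls (Inl s))" "order_preserving R S (\<lambda>r. cls (Inr r))"
proof -
  have "(Inl s, Inl t) \<in> glue_le" if "(s, t) \<in> C" for s t
    using that unfolding poset_glue_def Let_def by (intro r_into_trancl) auto
  then show "order_preserving C S (\<lambda>s. cls (Inl s))"
    by (auto simp: order_preserving_def Field_poset_pushout[OF C R incl \<phi>]
        poset_class_le_iff[OF C R] FieldI1 FieldI2)
  have "(Inr s, Inr t) \<in> glue_le" if "(s, t) \<in> R" for s t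
    using that unfolding poset_glue_def Let_def by (intro r_into_trancl) auto
  then show "order_preserving R S (\<lambda>s. cls (Inr s))"
    by (auto simp: order_preserving_def Field_poset_pushout[OF C R incl \<phi>]
        poset_class_le_iff[OF C R] FieldI1 FieldI2)
qed

lemma nerve_cls_commute:
  "a \<in> smp (nerve P) n \<Longrightarrow> nerve_map (\<lambda>s. cls (Inl s)) n (nerve_map (\<lambda>p. (p, 0)) n a) =
      nerve_map (\<lambda>r. cls (Inr r)) n (nerve_map \<phi> n a)"
  using cls_glue
  by (auto simp: nerve_map_def compose_def restrict_def fun_eq_iff order_maps_def PiE_iff)

text \<open>The cocone is the one that defines \<open>cr\<close>, so the items on
  \<open>pushout_desc\<close> evaluate \<open>cr\<close>. The compatibility of its legs stays a
  premise, to be discharged by \<open>nerve_cls_commute\<close>.\<close>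

lemmas T_universal = pushout_universal[OF simplicial_set_nerve simplicial_set_nerve
    simplicial_set_nerve simplicial_map_nerve[OF incl] simplicial_map_nerve[OF \<phi>]
    simplicial_map_nerve[OF cls_order_preserving(1)] simplicial_map_nerve[OF cls_order_preserving(2)],
    folded top_cylinder_def]

lemma proj_Inl: "simplicial_map (nerve C) T (\<lambda>n x. proj n (Inl x))"
  by (rule T_universal(2)) (rule nerve_cls_commute)

lemma proj_Inr: "simplicial_map (nerve R) T (\<lambda>n x. proj n (Inr x))"
  by (rule T_universal(3)) (rule nerve_cls_commute)

lemma proj_glue:
  "a \<in> order_maps (ordinal n) P \<Longrightarrow>
     proj n (Inl (nerve_map (\<lambda>p. (p, 0)) n a)) = proj n (Inr (nerve_map \<phi> n a))"
  using T_universal(4)[OF nerve_cls_commute, of a n] by simp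

lemma cr_q_Inl: "a \<in> order_maps (ordinal n) C \<Longrightarrow> k \<le> n \<Longrightarrow> cr P R \<phi> n (proj n (Inl a)) k = cls (Inl (a k))"
  using T_universal(6)[OF nerve_cls_commute, of a n] by (simp add: cr_def Let_def nerve_map_def compose_def)

lemma cr_q_Inr: "b \<in> order_maps (ordinal n) R \<Longrightarrow> k \<le> n \<Longrightarrow> cr P R \<phi> n (proj n (Inr b)) k = cls (Inr (b k))"
  using T_universal(7)[OF nerve_cls_commute, of b n] by (simp add: cr_def Let_def nerve_map_def compose_def)

text \<open>A chain at level 0 comes from a chain of \<open>P\<close>, and \<open>proj_glue\<close>
  carries it to \<open>R\<close>.\<close>

lemma Inl_bottom:
  assumes a: "a \<in> order_maps (ordinal n) C" and 0: "\<And>k. k \<le> n \<Longrightarrow> snd (a k) = 0"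
  shows "nerve_map \<phi> n (\<lambda>k\<in>{..n}. fst (a k)) \<in> order_maps (ordinal n) R"
    and "proj n (Inl a) = proj n (Inr (nerve_map \<phi> n (\<lambda>k\<in>{..n}. fst (a k))))"
proof -
  let ?b = "\<lambda>k\<in>{..n}. fst (a k)"
  have b: "?b \<in> order_maps (ordinal n) P"
    using a by (intro order_maps_ordinalI) (auto dest: order_maps_ordinalD(1) simp: C_iff)
  then show "nerve_map \<phi> n ?b \<in> order_maps (ordinal n) R"
    unfolding nerve_map_def using \<phi> by (intro compose_order_preserving)
  have "a = nerve_map (\<lambda>p. (p, 0)) n ?b"
    using a 0 by (auto simp: nerve_map_def compose_def fun_eq_iff order_maps_def PiE_iff
        extensional_def prod_eq_iff)
  with proj_glue[OF b] show "proj n (Inl a) = proj n (Inr (nerve_map \<phi> n ?b))" by simp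
qed

text \<open>The level is monotone along a chain, so the last vertex decides: if it is at level 0,
  the whole chain is glued into \<open>R\<close>.\<close>

lemma T_cases:
  assumes "x \<in> smp T n"
  obtains b where "b \<in> order_maps (ordinal n) R" "x = proj n (Inr b)"
  | a where "a \<in> order_maps (ordinal n) C" "snd (a n) = 1" "x = proj n (Inl a)"
  using assms[unfolded top_cylinder_def]
proof (cases rule: smp_pushout_cases)
  case (1 a)
  then have a: "a \<in> order_maps (ordinal n) C" "x = proj n (Inl a)"
    by (simp_all add: quot_proj_def)
  have le: "snd (a k) \<le> snd (a n) \<and> snd (a n) \<le> 1" if "k \<le> n" for k
    using a(1) that by (auto simp: order_maps_def order_preserving_def C_iff)
  show thesis
  proof (cases "snd (a n) = 0")
    case True
    then show thesis using le that(1) Inl_bottom[OF a(1)] a(2) by simp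
  next
    case False
    then show thesis using le[of n] that(2) a by simp
  qed
next
  case (2 b)
  then show thesis using that(1) by (simp add: quot_proj_def)
qed

subsection \<open>The desingularized cylinder\<close>

abbreviation unit_proj where "unit_proj n s \<equiv> desing_unit T n (proj n s)"

lemma T: "simplicial_set T" using P R \<phi> by (rule simplicial_set_top_cylinder)

text \<open>Both chains are faces of the \<open>(m + 1)\<close>-simplex \<open>w\<close> that repeats position \<open>j\<close>, first with
  the entry of \<open>a\<close> and then with the entry of \<open>b\<close>.\<close>

lemma unit_step:
  assumes a: "a \<in> order_maps (ordinal m) C" and b: "b \<in> order_maps (ordinal m) C"
    and j: "j \<le> m" and ne: "\<And>k. k \<noteq> j \<Longrightarrow> a k = b k"
    and 0: "snd (a j) = 0" "snd (b j) = 0"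
    and le: "(fst (a j), fst (b j)) \<in> P" and eq: "\<phi> (fst (a j)) = \<phi> (fst (b j))"
  shows "unit_proj m (Inl a) = unit_proj m (Inl b)"
proof -
  interpret T: simplicial_set T by (rule T)
  interpret D: simplicial_set "desing T" by (rule T.simplicial_set_desing)
  define w where "w = (\<lambda>k\<in>{..Suc m}. if k \<le> j then a k else b (k - 1))"
  have aC: "(a k, a l) \<in> C" if "k \<le> l" "l \<le> m" for k l
    using a that by (auto simp: order_maps_def order_preserving_def)
  have bC: "(b k, b l) \<in> C" if "k \<le> l" "l \<le> m" for k l
    using b that by (auto simp: order_maps_def order_preserving_def)
  have C_trans: "(s, t) \<in> C \<Longrightarrow> (t, r) \<in> C \<Longrightarrow> (s, r) \<in> C" for s t r
    by (auto simp: C_iff intro: P_trans)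
  have ab: "(a j, b j) \<in> C" using le 0 by (auto simp: C_iff)
  have w: "w \<in> order_maps (ordinal (Suc m)) C"
  proof -
    have "(w k, w l) \<in> C" if "k \<le> l" "l \<le> Suc m" for k l
    proof -
      consider "l \<le> j" | "k \<le> j" "j < l" | "j < k" using that by linarith
      then show ?thesis
      proof cases
        \<comment> \<open>The passage from \<open>a\<close> to \<open>b\<close> goes through the
          comparison \<open>ab\<close> of their entries at \<open>j\<close>.\<close>
        case 2
        then have "(a k, a j) \<in> C" "(b j, b (l - 1)) \<in> C" using j that by (auto intro: aC bC)
        with 2 ab that show ?thesis by (auto simp: w_def intro: C_trans)
      qed (use that j in \<open>auto simp: w_def intro: aC bC\<close>)
    qed
    then show ?thesis by (intro order_maps_ordinalI) (auto simp: w_def)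
  qed
  \<comment> \<open>Omitting \<open>Suc j\<close> keeps the entry \<open>a j\<close>, omitting
    \<open>j\<close> keeps \<open>b j\<close>; \<open>ne\<close> covers the other positions.\<close>
  have wa: "compose {..m} w (coface m (Suc j)) = a"
    using a ne by (auto simp: w_def compose_def coface_def fun_eq_iff order_maps_def PiE_iff extensional_def)
  have wb: "compose {..m} w (coface m j) = b"
    using b ne by (auto simp: w_def compose_def coface_def fun_eq_iff order_maps_def PiE_iff extensional_def)
  note su = T.simplicial_map_desing_unit
  have uw: "unit_proj k (Inl (compose {..k} w \<alpha>)) = act (desing T) (Suc m) k (unit_proj (Suc m) (Inl w)) \<alpha>"
    if \<alpha>: "\<alpha> \<in> ops k (Suc m)" for k \<alpha>
    using simplicial_map_act[OF proj_Inl _ \<alpha>, of w] w simplicial_map_closed[OF proj_Inl, of w "Suc m"]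
      simplicial_map_act[OF su _ \<alpha>] by simp
  have ux: "unit_proj (Suc m) (Inl w) \<in> smp (desing T) (Suc m)"
    using simplicial_map_closed[OF su simplicial_map_closed[OF proj_Inl]] w by simp
  \<comment> \<open>Vertices \<open>j\<close> and \<open>Suc j\<close> of \<open>w\<close> are at
    level 0 with the same \<open>\<phi>\<close>-value, so the gluing already identifies them in
    \<open>T\<close>.\<close>
  have vert: "proj 0 (Inl (compose {..0} w (vertex_op i))) = proj 0 (Inr (\<lambda>k\<in>{..0}. \<phi> (fst (a j))))"
    if i: "i = j \<or> i = Suc j" for i
  proof -
    let ?v = "compose {..0} w (vertex_op i)"
    have v: "?v \<in> order_maps (ordinal 0) C"
      using i j by (intro compose_order_maps[OF w] vertex_op) auto
    have z: "snd (w i) = 0" "\<phi> (fst (w i)) = \<phi> (fst (a j))"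
      using i j 0 eq by (auto simp: w_def)
    then have "proj 0 (Inl ?v) = proj 0 (Inr (nerve_map \<phi> 0 (\<lambda>k\<in>{..0}. fst (?v k))))"
      by (intro Inl_bottom(2)[OF v]) (simp add: compose_def vertex_op_def)
    also have "nerve_map \<phi> 0 (\<lambda>k\<in>{..0}. fst (?v k)) = (\<lambda>k\<in>{..0}. \<phi> (fst (a j)))"
      using z by (auto simp: nerve_map_def compose_def vertex_op_def fun_eq_iff)
    finally show ?thesis .
  qed
  have "act (desing T) (Suc m) m (unit_proj (Suc m) (Inl w)) (coface m j) =
      act (desing T) (Suc m) m (unit_proj (Suc m) (Inl w)) (coface m (Suc j))"
    using T.nonsingular_desing ux j
  proof (rule D.nonsingular_adjacent_faces)
    show "act (desing T) (Suc m) 0 (unit_proj (Suc m) (Inl w)) (vertex_op j) =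
        act (desing T) (Suc m) 0 (unit_proj (Suc m) (Inl w)) (vertex_op (Suc j))"
      using j uw[of "vertex_op j" 0] uw[of "vertex_op (Suc j)" 0] vert[of j] vert[of "Suc j"]
      by (simp add: vertex_op)
  qed
  then show ?thesis
    using uw[of "coface m j" m] uw[of "coface m (Suc j)" m] wa wb j by (simp add: coface_ops)
qed

end

section \<open>Bijectivity from lifting and directedness\<close>

locale directed_cylinder = cylinder P R \<phi>
  for P :: "'p rel" and R :: "'r rel" and \<phi> :: "'p \<Rightarrow> 'r" +
  assumes lift: "(r, \<phi> p) \<in> R \<Longrightarrow> p \<in> Field P \<Longrightarrow> \<exists>q. (q, p) \<in> P \<and> \<phi> q = r"
    and directed: "(q, p) \<in> P \<Longrightarrow> (q', p) \<in> P \<Longrightarrow> \<phi> q = \<phi> q' \<Longrightarrow>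
      \<exists>m. (q, m) \<in> P \<and> (q', m) \<in> P \<and> (m, p) \<in> P \<and> \<phi> m = \<phi> q"
begin

text \<open>The lifts agree from \<open>j\<close> on, and the induction lowers \<open>j\<close>. The
  two entries just below lie under the common entry \<open>?p\<close>; directedness gives an upper
  bound \<open>r\<close> under \<open>?p\<close> with the same image, and \<open>unit_step\<close>
  replaces both entries by \<open>(r, 0)\<close>.\<close>

lemma unit_lifts_eq:
  assumes "a \<in> order_maps (ordinal m) C" "b \<in> order_maps (ordinal m) C" "j \<le> m"
    and "\<And>k. j \<le> k \<Longrightarrow> a k = b k"
    and "\<And>k. k < j \<Longrightarrow> snd (a k) = 0 \<and> snd (b k) = 0 \<and> \<phi> (fst (a k)) = \<phi> (fst (b k))"
  shows "unit_proj m (Inl a) = unit_proj m (Inl b)"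
  using assms
proof (induction j arbitrary: a b)
  case 0
  then have "a = b" by auto
  then show ?case by simp
next
  case (Suc j)
  note a = Suc.prems(1) and b = Suc.prems(2)
  let ?p = "fst (a (Suc j))"
  have eq: "\<phi> (fst (a j)) = \<phi> (fst (b j))" and 0: "snd (a j) = 0" "snd (b j) = 0"
    using Suc.prems(5)[of j] by simp_all
  have "(fst (a j), ?p) \<in> P" "(fst (b j), ?p) \<in> P"
    using order_maps_ordinalD(1)[OF a, of j "Suc j"] order_maps_ordinalD(1)[OF b, of j "Suc j"]
      Suc.prems(3,4) by (auto simp: C_iff)
  with directed eq obtain r where r: "(fst (a j), r) \<in> P" "(fst (b j), r) \<in> P" "(r, ?p) \<in> P"
    "\<phi> r = \<phi> (fst (a j))" by blast
  \<comment> \<open>Stated for any \<open>c\<close> to serve both \<open>a\<close> and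
    \<open>b\<close>. The new entry stays below \<open>c (Suc j)\<close>, hence below all later
    entries.\<close>
  have upd: "c(j := (r, 0)) \<in> order_maps (ordinal m) C \<and> unit_proj m (Inl c) = unit_proj m (Inl (c(j := (r, 0))))"
    if c: "c \<in> order_maps (ordinal m) C" "snd (c j) = 0" "(fst (c j), r) \<in> P"
      "c (Suc j) = a (Suc j)" "\<phi> r = \<phi> (fst (c j))" for c
  proof -
    note cC = order_maps_ordinalD[OF c(1)]
    have "((c(j := (r, 0))) k, (c(j := (r, 0))) l) \<in> C" if kl: "k \<le> l" "l \<le> m" for k l
    proof -
      consider "k \<noteq> j" "l \<noteq> j" | "k < j" "l = j" | "k = j" "l = j" | "k = j" "Suc j \<le> l"
        using kl by linarith
      then show ?thesis
      proof cases
        case 1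
        then show ?thesis using cC(1) kl by simp
      next
        case 2
        then show ?thesis using cC(1)[of k j] kl c(2,3) by (auto simp: C_iff intro: P_trans)
      next
        case 3
        then show ?thesis using P_refl[of r] r(1) by (auto simp: C_iff intro: FieldI2)
      next
        case 4
        then show ?thesis using cC(1)[of "Suc j" l] kl c(4) r(3) by (auto simp: C_iff intro: P_trans)
      qed
    qed
    moreover have "c(j := (r, 0)) \<in> extensional {..m}"
      using cC(3) Suc.prems(3) by (auto simp: extensional_def)
    ultimately have "c(j := (r, 0)) \<in> order_maps (ordinal m) C" by (intro order_maps_ordinalI)
    moreover from this have "unit_proj m (Inl c) = unit_proj m (Inl (c(j := (r, 0))))"
      by (rule unit_step[OF c(1), of _ j]) (use c Suc.prems(3) in auto)
    ultimately show ?thesis by simp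
  qed
  let ?a = "a(j := (r, 0))" and ?b = "b(j := (r, 0))"
  have a': "?a \<in> order_maps (ordinal m) C \<and> unit_proj m (Inl a) = unit_proj m (Inl ?a)"
    using a 0 r by (intro upd) auto
  have b': "?b \<in> order_maps (ordinal m) C \<and> unit_proj m (Inl b) = unit_proj m (Inl ?b)"
    using b 0 r eq Suc.prems(4) by (intro upd) auto
  have "unit_proj m (Inl ?a) = unit_proj m (Inl ?b)"
  proof (rule Suc.IH)
    fix k assume "j \<le> k"
    then show "?a k = ?b k" using Suc.prems(4)[of k] by (cases "k = j") auto
  next
    fix k assume "k < j"
    then show "snd (?a k) = 0 \<and> snd (?b k) = 0 \<and> \<phi> (fst (?a k)) = \<phi> (fst (?b k))"
      using Suc.prems(5)[of k] by simp
  qed (use conjunct1[OF a'] conjunct1[OF b'] Suc.prems(3) in \<open>simp_all del: fun_upd_apply\<close>)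
  with a' b' show ?case by simp
qed

text \<open>The top \<open>p\<close> is prescribed; going down, \<open>lift\<close> picks each
  element below the previous one.\<close>

lemma chain_lift:
  fixes i :: nat
  assumes "\<And>k l. k \<le> l \<Longrightarrow> l \<le> i \<Longrightarrow> (r k, r l) \<in> R" and "p \<in> Field P" "r i = \<phi> p"
  shows "\<exists>f. f i = p \<and> (\<forall>k l. k \<le> l \<and> l \<le> i \<longrightarrow> (f k, f l) \<in> P) \<and> (\<forall>k\<le>i. \<phi> (f k) = r k)"
  using assms
proof (induction i arbitrary: p)
  case 0
  then show ?case by (intro exI[of _ "\<lambda>_. p"]) (auto intro: P_refl)
next
  case (Suc i)
  have "(r i, \<phi> p) \<in> R" using Suc.prems(1)[of i "Suc i"] Suc.prems(3) by simp
  with lift Suc.prems(2) obtain p' where p': "(p', p) \<in> P" "\<phi> p' = r i" by blast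
  have "p' \<in> Field P" using p'(1) by (rule FieldI1)
  with Suc.IH[of p'] Suc.prems(1) p'(2) obtain f where f: "f i = p'"
    "\<And>k l. k \<le> l \<Longrightarrow> l \<le> i \<Longrightarrow> (f k, f l) \<in> P" "\<And>k. k \<le> i \<Longrightarrow> \<phi> (f k) = r k"
    by auto
  let ?f = "f(Suc i := p)"
  have "(?f k, ?f l) \<in> P" if kl: "k \<le> l" "l \<le> Suc i" for k l
  proof -
    consider "l \<le> i" | "k \<le> i" "l = Suc i" | "k = Suc i" "l = Suc i" using kl by linarith
    then show ?thesis
    proof cases
      case 2
      then show ?thesis using f(2)[of k i] f(1) p'(1) by (auto intro: P_trans)
    qed (use kl f(2) P_refl[OF Suc.prems(2)] in auto)
  qed
  with f p' Suc.prems(3) show ?case by (intro exI[of _ ?f]) (auto simp: le_Suc_eq)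
qed

text \<open>By \<open>cyl_le\<close>, a chain of representatives cannot return from \<open>P\<close>
  to \<open>R\<close>. Unless it stays in \<open>R\<close>, its part in \<open>R\<close>, capped by
  the image of the first element \<open>p\<close> from \<open>P\<close>, lifts to a chain in
  \<open>P\<close> ending at \<open>p\<close>; the lift is placed at level 0.\<close>

lemma cr_surj:
  assumes c: "c \<in> order_maps (ordinal n) S"
  shows "\<exists>x\<in>smp T n. cr P R \<phi> n x = c"
proof -
  \<comment> \<open>A right inverse of \<open>normal_form\<close>: elements of \<open>P\<close> are
    put at level 1.\<close>
  define pt :: "'p + 'r \<Rightarrow> 'p \<times> nat + 'r" where "pt = map_sum (\<lambda>p. (p, 1)) (\<lambda>r. r)"
  have "\<exists>v :: 'p + 'r. v \<in> Field P <+> Field R \<and> c k = cls (pt v)" if "k \<le> n" for k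
    using order_maps_ordinalD(2)[OF c that]
  proof (cases rule: S_elem)
    case (1 p)
    then show ?thesis by (intro exI[of _ "Inl p"]) (auto simp: pt_def)
  next
    case (2 r)
    then show ?thesis by (intro exI[of _ "Inr r"]) (auto simp: pt_def)
  qed
  then have "\<exists>v. \<forall>k\<in>{..n}. v k \<in> Field P <+> Field R \<and> c k = cls (pt (v k))"
    by (intro bchoice) simp
  then obtain v where v: "\<And>k. k \<le> n \<Longrightarrow> v k \<in> Field P <+> Field R"
    "\<And>k. k \<le> n \<Longrightarrow> c k = cls (pt (v k))" by auto
  have ptF: "pt w \<in> Field C <+> Field R" "normal_form (pt w) = w" if "w \<in> Field P <+> Field R" for w
    using that by (auto simp: pt_def Field_C)
  have le: "cyl_le (v k) (v l)" if "k \<le> l" "l \<le> n" for k l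
    using S_normal_form[of "pt (v k)" "pt (v l)"] order_maps_ordinalD(1)[OF c that] v ptF that by simp
  have ceq: "x = c" if "x \<in> order_maps (ordinal n) S" "\<And>k. k \<le> n \<Longrightarrow> x k = cls (pt (v k))" for x
    using order_maps_ordinal_ext[OF that(1) c] that(2) v(2) by auto
  note cr = simplicial_map_closed[OF simplicial_map_cr[OF P R \<phi>], unfolded red_cylinder_def nerve_simps]
  show ?thesis
  proof (cases "\<exists>k\<le>n. \<exists>p. v k = Inl p")
    case False
    define b where "b = (\<lambda>k\<in>{..n}. projr (v k))"
    have b: "v k = Inr (b k)" if "k \<le> n" for k
      using False that by (cases "v k") (auto simp: b_def)
    have "(b k, b l) \<in> R" if "k \<le> l" "l \<le> n" for k l
      using le[OF that] b that by simp
    then have bR: "b \<in> order_maps (ordinal n) R" by (intro order_maps_ordinalI) (auto simp: b_def)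
    then have "proj n (Inr b) \<in> smp T n" using simplicial_map_closed[OF proj_Inr, of b n] by simp
    moreover from this have "cr P R \<phi> n (proj n (Inr b)) = c"
      by (intro ceq cr) (simp_all add: cr_q_Inr[OF bR] b pt_def)
    ultimately show ?thesis by blast
  next
    case True
    define i where "i = (LEAST k. k \<le> n \<and> (\<exists>p. v k = Inl p))"
    have "i \<le> n \<and> (\<exists>p. v i = Inl p)" using LeastI_ex[OF True] unfolding i_def .
    then obtain p where i: "i \<le> n" "v i = Inl p" by blast
    have below: "\<exists>r. v k = Inr r" if "k < i" for k
      using not_less_Least[of k "\<lambda>k. k \<le> n \<and> (\<exists>p. v k = Inl p)"] that i(1)
      unfolding i_def[symmetric] by (cases "v k") auto
    have above: "\<exists>p. v k = Inl p" if "i \<le> k" "k \<le> n" for k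
      using le[OF that] i by (cases "v k") auto
    \<comment> \<open>Below \<open>i\<close> these are the entries in \<open>R\<close>; at
      \<open>i\<close> the value is \<open>\<phi> p\<close>, so \<open>chain_lift\<close> applies
      with top \<open>p\<close>.\<close>
    define r where "r k = case_sum \<phi> (\<lambda>r. r) (v k)" for k
    have p: "p \<in> Field P" using v(1)[OF i(1)] i(2) by auto
    have rR: "(r k, r l) \<in> R" if "k \<le> l" "l \<le> i" for k l
      using le[of k l] that i p below[of k] below[of l] R_refl[OF \<phi>_Field[OF p]]
      by (cases "k = i"; cases "l = i") (auto simp: r_def)
    have "r i = \<phi> p" using i(2) by (simp add: r_def)
    with rR p have "\<exists>f. f i = p \<and> (\<forall>k l. k \<le> l \<and> l \<le> i \<longrightarrow> (f k, f l) \<in> P) \<and> (\<forall>k\<le>i. \<phi> (f k) = r k)"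
      by (rule chain_lift)
    then obtain f where f: "f i = p"
      "\<And>k l. k \<le> l \<Longrightarrow> l \<le> i \<Longrightarrow> (f k, f l) \<in> P" "\<And>k. k \<le> i \<Longrightarrow> \<phi> (f k) = r k"
      by blast
    \<comment> \<open>Position \<open>i\<close> carries \<open>(p, 1)\<close>; the equation
      \<open>f i = p\<close> links the entries below to it.\<close>
    define a where "a = (\<lambda>k\<in>{..n}. if k < i then (f k, 0) else (projl (v k), 1::nat))"
    have "(a k, a l) \<in> C" if kl: "k \<le> l" "l \<le> n" for k l
    proof -
      consider "l < i" | "k < i" "i \<le> l" | "i \<le> k" using kl by linarith
      then show ?thesis
      proof cases
        case 1
        then show ?thesis using kl f(2) by (auto simp: a_def C_iff)
      next
        case 2
        obtain p' where p': "v l = Inl p'" using above[of l] 2 kl by blast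
        have "(f k, p) \<in> P" "(p, p') \<in> P"
          using 2 kl f(1) f(2)[of k i] le[of i l] i(2) p' by simp_all
        then have "(f k, p') \<in> P" by (rule P_trans)
        then show ?thesis using 2 kl p' by (simp add: a_def C_iff)
      next
        case 3
        obtain p1 p2 where "v k = Inl p1" "v l = Inl p2"
          using above[of k] above[of l] 3 kl by fastforce
        then show ?thesis using 3 kl le[of k l] by (simp add: a_def C_iff)
      qed
    qed
    then have aC: "a \<in> order_maps (ordinal n) C" by (intro order_maps_ordinalI) (auto simp: a_def)
    have ak: "cls (Inl (a k)) = cls (pt (v k))" if "k \<le> n" for k
    proof (cases "k < i")
      case True
      have "(f k, f k) \<in> P" using True by (intro f(2)) simp_all
      then have "cls (Inl (f k, 0)) = cls (Inr (\<phi> (f k)))" by (intro cls_glue FieldI1)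
      moreover obtain r' where "v k = Inr r'" using below[OF True] by blast
      ultimately show ?thesis using True that f(3)[of k] by (simp add: a_def pt_def r_def)
    next
      case False
      then obtain p' where "v k = Inl p'" using above[of k] \<open>k \<le> n\<close> by auto
      with False that show ?thesis by (simp add: a_def pt_def)
    qed
    have "proj n (Inl a) \<in> smp T n" using simplicial_map_closed[OF proj_Inl, of a n] aC by simp
    moreover from this have "cr P R \<phi> n (proj n (Inl a)) = c"
      by (intro ceq cr) (simp_all add: cr_q_Inl[OF aC] ak)
    ultimately show ?thesis by blast
  qed
qed

text \<open>Vertexwise normal forms decide. They determine a chain in \<open>R\<close>; two chains
  of \<open>C\<close> ending at level 1 agree at level 1 and have equal \<open>\<phi>\<close>-values
  at level 0, which is the situation of \<open>unit_lifts_eq\<close>.\<close>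

lemma unit_eq_if_cr_eq:
  assumes x: "x \<in> smp T n" and x': "x' \<in> smp T n" and eq: "cr P R \<phi> n x = cr P R \<phi> n x'"
  shows "desing_unit T n x = desing_unit T n x'"
proof -
  \<comment> \<open>The last vertices have normal forms in different summands.\<close>
  have mixed: False if b: "b \<in> order_maps (ordinal n) R" and a: "a \<in> order_maps (ordinal n) C"
    "snd (a n) = 1" and e: "cr P R \<phi> n (proj n (Inr b)) = cr P R \<phi> n (proj n (Inl a))" for a b
  proof -
    have "cls (Inr (b n)) = cls (Inl (a n))"
      using fun_cong[OF e, of n] by (simp add: cr_q_Inl[OF a(1)] cr_q_Inr[OF b])
    then have "normal_form (Inr (b n)) = normal_form (Inl (a n))"
      by (rule cls_normal_form)
        (use order_maps_ordinalD(2)[OF a(1), of n] order_maps_ordinalD(2)[OF b, of n] in auto)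
    with a(2) show False by (cases "a n") simp
  qed
  show ?thesis
    using x
  proof (cases rule: T_cases)
    case x1: (1 b)
    show ?thesis
      using x'
    proof (cases rule: T_cases)
      case (1 b')
      have "b k = b' k" if "k \<le> n" for k
      proof -
        have "cls (Inr (b k)) = cls (Inr (b' k))"
          using fun_cong[OF eq, of k] x1 1 that by (simp add: cr_q_Inr)
        then have "normal_form (Inr (b k)) = normal_form (Inr (b' k))"
          by (rule cls_normal_form) (use order_maps_ordinalD(2)[OF x1(1) that] order_maps_ordinalD(2)[OF 1(1) that] in auto)
        then show ?thesis by simp
      qed
      then have "b = b'" using x1(1) 1(1) by (intro order_maps_ordinal_ext)
      with x1 1 show ?thesis by simp
    next
      case (2 a)
      with mixed[OF x1(1) 2(1,2)] x1 eq show ?thesis by simp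
    qed
  next
    case x2: (2 a)
    show ?thesis
      using x'
    proof (cases rule: T_cases)
      case (1 b)
      with mixed[OF 1(1) x2(1,2)] x2 eq show ?thesis by simp
    next
      case (2 a')
      have nf: "normal_form (Inl (a k)) = normal_form (Inl (a' k))" if "k \<le> n" for k
      proof (rule cls_normal_form)
        show "cls (Inl (a k)) = cls (Inl (a' k))"
          using fun_cong[OF eq, of k] x2 2 that by (simp add: cr_q_Inl)
      qed (use order_maps_ordinalD(2)[OF x2(1) that] order_maps_ordinalD(2)[OF 2(1) that] in auto)
      have le1: "snd (a k) \<le> 1" "snd (a' k) \<le> 1" if "k \<le> n" for k
        using order_maps_ordinalD(1)[OF x2(1), of k k] order_maps_ordinalD(1)[OF 2(1), of k k] that
        by (auto simp: C_iff)
      have snd_eq: "snd (a k) = snd (a' k)" if "k \<le> n" for k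
        using nf[OF that] le1[OF that]
        by (cases "a k"; cases "a' k") (auto split: if_splits)
      define j where "j = (LEAST k. k \<le> n \<and> snd (a k) = 1)"
      have j: "j \<le> n" "snd (a j) = 1"
        using LeastI[of "\<lambda>k. k \<le> n \<and> snd (a k) = 1" n] x2(2) by (auto simp: j_def)
      have lt: "snd (a k) = 0" if "k < j" for k
        using not_less_Least[of k "\<lambda>k. k \<le> n \<and> snd (a k) = 1"] that j(1) le1[of k]
        unfolding j_def[symmetric] by auto
      have ge: "a k = a' k" if "j \<le> k" for k
      proof (cases "k \<le> n")
        case True
        then have "snd (a k) = 1"
          using order_maps_ordinalD(1)[OF x2(1) that] j(2) by (auto simp: C_iff)
        then show ?thesis using nf[OF True] snd_eq[OF True]
          by (cases "a k"; cases "a' k") auto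
      next
        \<comment> \<open>\<open>unit_lifts_eq\<close> asks for equality at all indices; beyond
          \<open>n\<close> both chains are \<open>undefined\<close>.\<close>
        case False
        then show ?thesis
          using order_maps_ordinalD(3)[OF x2(1)] order_maps_ordinalD(3)[OF 2(1)]
          by (simp add: extensional_def)
      qed
      have "unit_proj n (Inl a) = unit_proj n (Inl a')"
        using x2(1) 2(1) j(1) ge
      proof (rule unit_lifts_eq)
        fix k assume k: "k < j"
        then show "snd (a k) = 0 \<and> snd (a' k) = 0 \<and> \<phi> (fst (a k)) = \<phi> (fst (a' k))"
          using lt[OF k] snd_eq[of k] nf[of k] j(1) by (cases "a k"; cases "a' k") auto
      qed
      with x2 2 show ?thesis by simp
    qed
  qed
qed

text \<open>The unit is surjective and \<open>dcr\<close> after it is \<open>cr\<close>, so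
  bijectivity of \<open>dcr\<close> reduces to \<open>unit_eq_if_cr_eq\<close> and
  \<open>cr_surj\<close>.\<close>

theorem simplicial_iso_dcr:
  shows "simplicial_iso (desing T) (red_cylinder P R \<phi>) (dcr P R \<phi>)"
proof -
  interpret T: simplicial_set T by (rule T)
  note dcr = simplicial_map_dcr[OF P R \<phi>] and unit = dcr_unit[OF P R \<phi>]
  have elem: "\<exists>x\<in>smp T n. c = desing_unit T n x" if "c \<in> smp (desing T) n" for n c
    using that by (auto simp: desing_def smp_quot desing_unit_def quot_proj_def elim: quotientE)
  show ?thesis
    using T.simplicial_set_desing dcr
  proof (rule simplicial_iso_bij)
    fix n
    show "bij_betw (dcr P R \<phi> n) (smp (desing T) n) (smp (red_cylinder P R \<phi>) n)"
    proof (rule bij_betw_imageI)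
      show "inj_on (dcr P R \<phi> n) (smp (desing T) n)"
      proof (rule inj_onI)
        fix c c' assume *: "c \<in> smp (desing T) n" "c' \<in> smp (desing T) n"
          "dcr P R \<phi> n c = dcr P R \<phi> n c'"
        from elem *(1,2) obtain x x' where x: "x \<in> smp T n" "c = desing_unit T n x"
          "x' \<in> smp T n" "c' = desing_unit T n x'" by blast
        have "cr P R \<phi> n x = cr P R \<phi> n x'" using *(3) unit x by simp
        with unit_eq_if_cr_eq[OF x(1,3)] x show "c = c'" by simp
      qed
      show "dcr P R \<phi> n ` smp (desing T) n = smp (red_cylinder P R \<phi>) n"
      proof (intro equalityI subsetI)
        fix c assume "c \<in> smp (red_cylinder P R \<phi>) n"
        then have "c \<in> order_maps (ordinal n) S" by (simp add: red_cylinder_def)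
        with cr_surj obtain x where "x \<in> smp T n" "cr P R \<phi> n x = c" by blast
        then show "c \<in> dcr P R \<phi> n ` smp (desing T) n"
          using unit simplicial_map_closed[OF T.simplicial_map_desing_unit]
          by (intro image_eqI[of _ _ "desing_unit T n x"]) auto
      qed (use simplicial_map_closed[OF dcr] in blast)
    qed
  qed
qed

end

subsection \<open>Operators and their images\<close>

text \<open>The operator lists \<open>A\<close> in increasing order; its source has
  \<open>c + 1\<close> elements, hence the length \<open>Suc c\<close>.\<close>

lemma ops_with_image:
  assumes "A \<subseteq> {..k}" "A \<noteq> {}"
  obtains c \<nu> where "\<nu> \<in> ops c k" "inj_on \<nu> {..c}" "\<nu> ` {..c} = A"
proof -
  define xs where "xs = sorted_list_of_set A"
  have A: "finite A" using assms(1) finite_subset by blast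
  then have xs: "set xs = A" "sorted xs" "distinct xs" by (simp_all add: xs_def)
  then obtain c where c: "length xs = Suc c"
    using assms(2) by (cases xs) auto
  have idx: "{..c} = {..<length xs}" using c by auto
  define \<nu> where "\<nu> = (\<lambda>i\<in>{..c}. xs ! i)"
  have im: "\<nu> ` {..c} = A"
    unfolding xs(1)[symmetric] idx set_conv_nth using idx by (auto simp: \<nu>_def image_iff)
  moreover have "inj_on \<nu> {..c}"
    using xs(3) c by (auto simp: inj_on_def \<nu>_def nth_eq_iff_index_eq)
  moreover have "\<nu> \<in> ops c k"
  proof -
    have "\<nu> i \<le> k" if "i \<le> c" for i using im assms(1) that by auto
    moreover have "\<nu> i \<le> \<nu> j" if "i \<le> j" "j \<le> c" for i j
      using that xs(2) c by (auto simp: \<nu>_def intro: sorted_nth_mono)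
    ultimately show ?thesis by (auto simp: ops_iff PiE_iff \<nu>_def)
  qed
  ultimately show thesis using that by blast
qed

text \<open>Apply \<open>\<mu>\<close> and then the inverse of \<open>\<nu>\<close> on its image,
  which is monotone since \<open>\<nu>\<close> is monotone and injective.\<close>

lemma ops_factor:
  assumes \<mu>: "\<mu> \<in> ops a k" and \<nu>: "\<nu> \<in> ops b k" "inj_on \<nu> {..b}" and sub: "\<mu> ` {..a} \<subseteq> \<nu> ` {..b}"
  obtains \<rho> where "\<rho> \<in> ops a b" "\<mu> = compose {..a} \<nu> \<rho>"
proof -
  define \<rho> where "\<rho> = (\<lambda>i\<in>{..a}. the_inv_into {..b} \<nu> (\<mu> i))"
  have \<rho>: "\<rho> i \<le> b" "\<nu> (\<rho> i) = \<mu> i" if "i \<le> a" for i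
  proof -
    have *: "\<mu> i \<in> \<nu> ` {..b}" using sub that by auto
    show "\<rho> i \<le> b" using the_inv_into_into[OF \<nu>(2) *, of "{..b}"] that by (simp add: \<rho>_def)
    show "\<nu> (\<rho> i) = \<mu> i" using f_the_inv_into_f[OF \<nu>(2) *] that by (simp add: \<rho>_def)
  qed
  have "\<rho> i \<le> \<rho> j" if "i \<le> j" "j \<le> a" for i j
  proof (rule ccontr)
    assume "\<not> \<rho> i \<le> \<rho> j"
    then have "\<nu> (\<rho> j) \<le> \<nu> (\<rho> i)" using \<rho>(1)[of i] that by (intro ops_mono[OF \<nu>(1)]) auto
    moreover have "\<mu> i \<le> \<mu> j" using that by (intro ops_mono[OF \<mu>])
    ultimately have "\<nu> (\<rho> i) = \<nu> (\<rho> j)" using \<rho>(2)[of i] \<rho>(2)[of j] that by simp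
    then have "\<rho> i = \<rho> j" using inj_onD[OF \<nu>(2)] \<rho>(1)[of i] \<rho>(1)[of j] that by auto
    with \<open>\<not> \<rho> i \<le> \<rho> j\<close> show False by simp
  qed
  then have "\<rho> \<in> ops a b" using \<rho>(1) by (auto simp: ops_iff PiE_iff \<rho>_def)
  moreover have "\<mu> = compose {..a} \<nu> \<rho>"
    using \<mu> \<rho>(2) by (auto simp: compose_def fun_eq_iff ops_iff PiE_iff extensional_def)
  ultimately show thesis by (rule that)
qed

lemma compose_image: "compose A f g ` A = f ` g ` A"
  by (auto simp: compose_def)

lemma ops_image: "\<alpha> \<in> ops m n \<Longrightarrow> \<alpha> ` {..m} \<subseteq> {..n}"
  by (auto dest: ops_le)

section \<open>Non-degenerate parts of faces\<close>

context simplicial_set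
begin

lemma sharp_eqI:
  assumes "w \<in> nondeg X m" "\<sigma> \<in> ops n m" "\<sigma> ` {..n} = {..m}"
  shows "sharp X n (act X m n w \<sigma>) = (m, w)"
  unfolding sharp_def
  by (rule the1_equality[OF eilenberg_zilber]) (use assms in \<open>auto intro!: act_closed dest: nondeg_smp\<close>)

lemma sharp_act_surj:
  assumes x: "x \<in> smp X n" and \<sigma>: "\<sigma> \<in> ops k n" "\<sigma> ` {..k} = {..n}"
  shows "sharp X k (act X n k x \<sigma>) = sharp X n x"
proof -
  obtain m w \<tau> where w: "sharp X n x = (m, w)" "w \<in> nondeg X m" "\<tau> \<in> ops n m"
    "\<tau> ` {..n} = {..m}" "x = act X m n w \<tau>" using x by (rule sharpE)
  have "act X n k x \<sigma> = act X m k w (compose {..k} \<tau> \<sigma>)"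
    using act_comp[OF nondeg_smp[OF w(2)] w(3) \<sigma>(1)] w(5) by simp
  then show ?thesis
    using sharp_eqI[OF w(2) compose_ops[OF w(3) \<sigma>(1)]] w \<sigma>(2) by (simp add: compose_image)
qed

lemma sharp_nondeg: "w \<in> nondeg X m \<Longrightarrow> sharp X m w = (m, w)"
  using sharp_eqI[of w m "id_op m" m] act_id[of w m] nondeg_smp[of w X m] by simp

text \<open>Both operators are surjections followed by one injective operator with the common image,
  and surjections do not change the non-degenerate part. So only the vertex set of a face
  matters.\<close>

lemma sharp_cong_image:
  assumes x: "x \<in> smp X k" and \<mu>: "\<mu> \<in> ops a k" and \<nu>: "\<nu> \<in> ops b k"
    and im: "\<mu> ` {..a} = \<nu> ` {..b}"
  shows "sharp X a (act X k a x \<mu>) = sharp X b (act X k b x \<nu>)"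
proof -
  obtain c \<iota> where \<iota>: "\<iota> \<in> ops c k" "inj_on \<iota> {..c}" "\<iota> ` {..c} = \<mu> ` {..a}"
    using ops_with_image[OF ops_image[OF \<mu>]] by (metis image_is_empty atMost_iff empty_iff le0)
  have *: "sharp X d (act X k d x \<kappa>) = sharp X c (act X k c x \<iota>)"
    if \<kappa>: "\<kappa> \<in> ops d k" "\<kappa> ` {..d} = \<iota> ` {..c}" for d \<kappa>
  proof -
    obtain \<rho> where \<rho>: "\<rho> \<in> ops d c" "\<kappa> = compose {..d} \<iota> \<rho>"
      using ops_factor[OF \<kappa>(1) \<iota>(1,2)] \<kappa>(2) by blast
    have "\<iota> ` \<rho> ` {..d} = \<iota> ` {..c}" using \<kappa>(2) \<rho>(2) by (simp add: compose_image)
    \<comment> \<open>Injectivity of \<open>\<iota>\<close> turns equality of images into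
      surjectivity of \<open>\<rho>\<close>.\<close>
    then have "\<rho> ` {..d} = {..c}"
      using inj_on_image_eq_iff[OF \<iota>(2) ops_image[OF \<rho>(1)]] by simp
    then show ?thesis
      using sharp_act_surj[OF act_closed[OF x \<iota>(1)] \<rho>(1)] act_comp[OF x \<iota>(1) \<rho>(1)] \<rho>(2) by simp
  qed
  show ?thesis using *[OF \<mu>] *[OF \<nu>] \<iota>(3) im by simp
qed

subsection \<open>Faces of simplices of a regular simplicial set\<close>

lemma generated_simps:
  "smp (generated X n x) m = (\<lambda>\<alpha>. act X n m x \<alpha>) ` ops m n"
  "act (generated X n x) = act X"
  by (simp_all add: generated_def)

lemma simplicial_set_generated:
  assumes x: "x \<in> smp X n" shows "simplicial_set (generated X n x)"
proof
  have sub: "z \<in> smp X m" if "z \<in> smp (generated X n x) m" for z m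
    using that act_closed[OF x] by (auto simp: generated_simps)
  fix z m assume z: "z \<in> smp (generated X n x) m"
  show "act (generated X n x) m m z (id_op m) = z"
    unfolding generated_simps using sub[OF z] by (rule act_id)
  fix \<alpha> k assume \<alpha>: "\<alpha> \<in> ops k m"
  obtain \<beta> where \<beta>: "\<beta> \<in> ops m n" "z = act X n m x \<beta>" using z by (auto simp: generated_simps)
  show "act (generated X n x) m k z \<alpha> \<in> smp (generated X n x) k"
    unfolding generated_simps \<beta>(2) act_comp[OF x \<beta>(1) \<alpha>] using compose_ops[OF \<beta>(1) \<alpha>] by (rule imageI)
  fix \<gamma> l assume \<gamma>: "\<gamma> \<in> ops l k"
  show "act (generated X n x) k l (act (generated X n x) m k z \<alpha>) \<gamma> =
      act (generated X n x) m l z (compose {..l} \<alpha> \<gamma>)"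
    unfolding generated_simps using sub[OF z] \<alpha> \<gamma> by (rule act_comp)
qed

lemma simplicial_map_generated:
  assumes "x \<in> smp X n"
  shows "simplicial_map (std_simplex n) (generated X n x) (repr_map (generated X n x) n x)"
    and "simplicial_map (generated X n x) X (\<lambda>m z. z)"
  using assms by (auto simp: simplicial_map_def repr_map_def generated_def act_comp act_closed)

end

text \<open>Only the reflexive generating pair involves \<open>Inl a\<close>, so the closure never
  leaves it.\<close>

lemma glue_Inl_trivial:
  assumes "(Inl a, s) \<in> glue A X Y f g n" "a \<notin> f n ` smp A n"
  shows "s = Inl a"
  using assms(1) unfolding glue_def Let_def
  by (induction rule: trancl_induct) (use assms(2) in auto)

context simplicial_set
begin

text \<open>By regularity, equal faces of \<open>w\<close> come from equal classes in the pushout.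
  An operator hitting the last vertex does not factor through the last coface, so its class is a
  singleton.\<close>

lemma regular_simplex_unique:
  assumes reg: "regular_simplex X l w" and w: "w \<in> smp X l" and \<alpha>: "\<alpha> \<in> ops m l"
    and \<beta>: "\<beta> \<in> ops m l" and top: "l \<in> \<alpha> ` {..m}" and eq: "act X l m w \<alpha> = act X l m w \<beta>"
  shows "\<alpha> = \<beta>"
proof (cases l)
  case 0
  then show ?thesis using \<alpha> \<beta> by (intro ops_ext[OF \<alpha> \<beta>]) (auto dest!: ops_le)
next
  case (Suc k)
  define d where "d = coface k l"
  define z where "z = act X l k w d"
  define Y where "Y = generated X k z"
  have d: "d \<in> ops k l" unfolding d_def Suc by (rule coface_ops) simp
  have z: "z \<in> smp X k" unfolding z_def using w d by (rule act_closed)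
  have Y: "simplicial_set Y" unfolding Y_def using z by (rule simplicial_set_generated)
  have std: "simplicial_set (std_simplex i)" for i
    unfolding std_simplex_def by (rule simplicial_set_nerve)
  have dm: "simplicial_map (std_simplex k) (std_simplex l) (nerve_map d)"
    unfolding std_simplex_def by (rule simplicial_map_nerve) (use d in \<open>simp add: order_maps_def\<close>)
  note g = simplicial_map_generated[OF z, folded Y_def]
  have comm: "repr_map X l w i (nerve_map d i a) = repr_map Y k z i a"
    if "a \<in> smp (std_simplex k) i" for i a
    using that act_comp[OF w d] by (simp add: repr_map_def nerve_map_def Y_def generated_def z_def)
  note univ = pushout_universal[OF std Y std dm g(1) simplicial_map_repr_map[OF w] g(2)]
  let ?G = "glue (std_simplex k) (std_simplex l) Y (nerve_map d) (repr_map Y k z)"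
  let ?Q = "pushout (std_simplex k) (std_simplex l) Y (nerve_map d) (repr_map Y k z)"
  have cl: "quot_proj ?G m (Inl \<gamma>) \<in> smp ?Q m" if "\<gamma> \<in> ops m l" for \<gamma>
    using that by (auto simp: pushout_def smp_quot quot_proj_def intro!: quotientI)
  have val: "pushout_desc (repr_map X l w) (\<lambda>m x. x) m (quot_proj ?G m (Inl \<gamma>)) = act X l m w \<gamma>"
    if "\<gamma> \<in> ops m l" for \<gamma>
    unfolding repr_map_def[of X l w m \<gamma>, symmetric] by (rule univ(6)) (use comm that in simp_all)
  have "inj_on (pushout_desc (repr_map X l w) (\<lambda>m x. x) m) (smp ?Q m)"
    using reg[unfolded regular_simplex_def degreewise_injective_def Let_def, rule_format, OF Suc]
    unfolding d_def z_def Y_def .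
  then have "quot_proj ?G m (Inl \<alpha>) = quot_proj ?G m (Inl \<beta>)"
    using _ cl[OF \<alpha>] cl[OF \<beta>]
  proof (rule inj_onD)
    show "pushout_desc (repr_map X l w) (\<lambda>m x. x) m (quot_proj ?G m (Inl \<alpha>)) =
        pushout_desc (repr_map X l w) (\<lambda>m x. x) m (quot_proj ?G m (Inl \<beta>))"
      unfolding val[OF \<alpha>] val[OF \<beta>] by (rule eq)
  qed
  moreover have "(Inl \<beta>, Inl \<beta>) \<in> ?G m"
    unfolding glue_def Let_def using \<beta> by (intro r_into_trancl UnI1 Id_onI) simp
  ultimately have "(Inl \<alpha>, Inl \<beta>) \<in> ?G m" by (auto simp: quot_proj_def)
  moreover have "\<alpha> \<notin> nerve_map d m ` smp (std_simplex k) m"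
  proof
    assume "\<alpha> \<in> nerve_map d m ` smp (std_simplex k) m"
    then obtain \<gamma> where \<gamma>: "\<gamma> \<in> ops m k" "\<alpha> = compose {..m} d \<gamma>" by (auto simp: nerve_map_def)
    obtain i where i: "i \<le> m" "l = \<alpha> i" using top by blast
    then have "d (\<gamma> i) = l" unfolding \<gamma>(2) compose_def by simp
    moreover have "\<gamma> i < l" using ops_le[OF \<gamma>(1) i(1)] Suc by simp
    then have "d (\<gamma> i) = \<gamma> i" unfolding d_def coface_def using Suc by simp
    ultimately show False using \<open>\<gamma> i < l\<close> by simp
  qed
  ultimately show ?thesis by (auto dest: glue_Inl_trivial)
qed

text \<open>\<open>coface k (Suc k)\<close> is the inclusion, so \<open>\<alpha>\<close> itself
  serves as \<open>\<gamma>\<close>.\<close>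

lemma ops_avoiding_top:
  assumes "\<alpha> \<in> ops m (Suc k)" "Suc k \<notin> \<alpha> ` {..m}"
  obtains \<gamma> where "\<gamma> \<in> ops m k" "\<alpha> = compose {..m} (coface k (Suc k)) \<gamma>"
proof (rule that)
  have le: "\<alpha> i \<le> k" if "i \<le> m" for i
  proof -
    have "\<alpha> i \<noteq> Suc k" using assms(2) that by (metis atMost_iff image_eqI)
    with ops_le[OF assms(1) that] show ?thesis by simp
  qed
  then show "\<alpha> \<in> ops m k" using assms(1) by (simp add: ops_iff PiE_iff)
  show "\<alpha> = compose {..m} (coface k (Suc k)) \<alpha>"
  proof (rule extensionalityI[of _ "{..m}"])
    show "\<alpha> \<in> extensional {..m}" using assms(1) by (simp add: ops_iff PiE_iff)
    show "\<alpha> i = compose {..m} (coface k (Suc k)) \<alpha> i" if "i \<in> {..m}" for i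
      using le[of i] that by (simp add: compose_def coface_def)
  qed simp
qed

text \<open>The common non-degenerate part \<open>v\<close> is the face of \<open>w\<close> along
  \<open>?\<iota>\<close>, built from a section of \<open>\<rho>\<close>. Uniqueness yields first
  that \<open>\<tau>\<close> is \<open>?\<iota>\<close> after \<open>\<rho>\<close>, then that
  \<open>\<tau>'\<close> is \<open>?\<iota>\<close> after \<open>\<rho>'\<close>; both have the
  image of \<open>?\<iota>\<close>.\<close>

lemma sharp_eq_top:
  assumes reg: "regular_simplex X l w" and w: "w \<in> smp X l" and \<tau>: "\<tau> \<in> ops a l"
    and \<tau>': "\<tau>' \<in> ops b l" and top: "l \<in> \<tau> ` {..a}"
    and eq: "sharp X a (act X l a w \<tau>) = sharp X b (act X l b w \<tau>')"
  shows "\<tau>' ` {..b} = \<tau> ` {..a}"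
proof -
  obtain d v \<rho> where v: "sharp X a (act X l a w \<tau>) = (d, v)" "v \<in> nondeg X d" "\<rho> \<in> ops a d"
    "\<rho> ` {..a} = {..d}" "act X l a w \<tau> = act X d a v \<rho>"
    using act_closed[OF w \<tau>] by (rule sharpE)
  obtain \<rho>' where \<rho>': "\<rho>' \<in> ops b d" "\<rho>' ` {..b} = {..d}" "act X l b w \<tau>' = act X d b v \<rho>'"
    using sharpE[OF act_closed[OF w \<tau>']] eq v(1) by (metis prod.inject)
  obtain s where s: "s \<in> ops d a" "compose {..d} \<rho> s = id_op d"
    using ops_section[OF v(3,4)] by metis
  let ?\<iota> = "compose {..d} \<tau> s"
  have \<iota>: "?\<iota> \<in> ops d l" using \<tau> s(1) by (rule compose_ops)
  have "v = act X d d v (compose {..d} \<rho> s)" unfolding s(2) using act_id[OF nondeg_smp[OF v(2)]] by simp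
  also have "\<dots> = act X l d w ?\<iota>"
    using act_comp[OF nondeg_smp[OF v(2)] v(3) s(1)] act_comp[OF w \<tau> s(1)] v(5) by simp
  finally have vw: "v = act X l d w ?\<iota>" .
  have \<tau>_eq: "\<tau> = compose {..a} ?\<iota> \<rho>"
    using regular_simplex_unique[OF reg w \<tau> compose_ops[OF \<iota> v(3)] top]
      act_comp[OF w \<iota> v(3)] vw v(5) by simp
  then have im: "\<tau> ` {..a} = ?\<iota> ` {..d}" using v(4) compose_image by metis
  also have "\<dots> = compose {..b} ?\<iota> \<rho>' ` {..b}" using \<rho>'(2) by (simp only: compose_image)
  also have "compose {..b} ?\<iota> \<rho>' = \<tau>'"
  proof (rule regular_simplex_unique[OF reg w compose_ops[OF \<iota> \<rho>'(1)] \<tau>'])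
    show "l \<in> compose {..b} ?\<iota> \<rho>' ` {..b}"
      using top im \<rho>'(2) by (simp only: compose_image)
    show "act X l b w (compose {..b} ?\<iota> \<rho>') = act X l b w \<tau>'"
      using act_comp[OF w \<iota> \<rho>'(1)] vw \<rho>'(3) by simp
  qed
  finally show ?thesis by simp
qed

text \<open>Upper bounds are phrased through vertex sets. The induction admits degenerate
  \<open>x\<close>, since it passes to the last face of the non-degenerate part \<open>w\<close>,
  and that face may be degenerate.\<close>

lemma sharp_directed:
  assumes reg: "regular X" and "x \<in> smp X k" "\<mu> \<in> ops a k" "\<mu>' \<in> ops b k"
    and "sharp X a (act X k a x \<mu>) = sharp X b (act X k b x \<mu>')"
  shows "\<exists>c \<nu>. \<nu> \<in> ops c k \<and> \<mu> ` {..a} \<union> \<mu>' ` {..b} \<subseteq> \<nu> ` {..c} \<and>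
     sharp X c (act X k c x \<nu>) = sharp X a (act X k a x \<mu>)"
  using assms(2-)
proof (induction k arbitrary: x \<mu> \<mu>' rule: less_induct)
  case (less k)
  note x = less.prems(1) and \<mu> = less.prems(2) and \<mu>' = less.prems(3)
  obtain l w \<sigma> where w: "w \<in> nondeg X l" "\<sigma> \<in> ops k l" "\<sigma> ` {..k} = {..l}" "x = act X l k w \<sigma>"
    using x by (rule sharpE)
  note ws = nondeg_smp[OF w(1)]
  have xw: "act X k m x \<alpha> = act X l m w (compose {..m} \<sigma> \<alpha>)" if "\<alpha> \<in> ops m k" for m \<alpha>
    using act_comp[OF ws w(2) that] w(4) by simp
  have rw: "regular_simplex X l w" using reg w(1) by (simp add: regular_def)
  have lk: "l \<le> k"
    using ops_section[OF w(2,3)] ops_inj_le by metis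
  let ?\<tau> = "compose {..a} \<sigma> \<mu>" and ?\<tau>' = "compose {..b} \<sigma> \<mu>'"
  have \<tau>: "?\<tau> \<in> ops a l" and \<tau>': "?\<tau>' \<in> ops b l" using w(2) \<mu> \<mu>' by (auto intro: compose_ops)
  have eq: "sharp X a (act X l a w ?\<tau>) = sharp X b (act X l b w ?\<tau>')"
    using less.prems(4) xw \<mu> \<mu>' by simp
  have "\<exists>c \<nu>. \<nu> \<in> ops c l \<and> ?\<tau> ` {..a} \<union> ?\<tau>' ` {..b} \<subseteq> \<nu> ` {..c} \<and>
     sharp X c (act X l c w \<nu>) = sharp X a (act X l a w ?\<tau>)"
  \<comment> \<open>If either face contains the last vertex of \<open>w\<close>, the two vertex sets
    coincide and \<open>?\<tau>\<close> itself is the bound.\<close>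
  proof (cases "l \<in> ?\<tau> ` {..a} \<union> ?\<tau>' ` {..b}")
    case True
    then have "?\<tau>' ` {..b} = ?\<tau> ` {..a}"
    proof
      assume "l \<in> ?\<tau> ` {..a}"
      then show ?thesis using sharp_eq_top[OF rw ws \<tau> \<tau>' _ eq] by simp
    next
      assume "l \<in> ?\<tau>' ` {..b}"
      then show ?thesis using sharp_eq_top[OF rw ws \<tau>' \<tau> _ eq[symmetric]] by simp
    qed
    then show ?thesis using \<tau> by blast
  next
    case False
    \<comment> \<open>Vertex 0 is sent to some vertex other than \<open>l\<close>, so
      \<open>l\<close> is positive and has a last coface.\<close>
    then have "?\<tau> 0 \<noteq> l" by blast
    then obtain k' where l: "l = Suc k'"
      using ops_le[OF \<tau>, of 0] by (cases l) auto
    let ?d = "coface k' (Suc k')"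
    have d: "?d \<in> ops k' l" unfolding l by (rule coface_ops) simp
    obtain \<gamma> where \<gamma>: "\<gamma> \<in> ops a k'" "?\<tau> = compose {..a} ?d \<gamma>"
      using ops_avoiding_top[of ?\<tau> a k'] \<tau> False unfolding l by blast
    obtain \<gamma>' where \<gamma>': "\<gamma>' \<in> ops b k'" "?\<tau>' = compose {..b} ?d \<gamma>'"
      using ops_avoiding_top[of ?\<tau>' b k'] \<tau>' False unfolding l by blast
    let ?z = "act X l k' w ?d"
    have z: "?z \<in> smp X k'" using ws d by (rule act_closed)
    have zw: "act X k' m ?z \<alpha> = act X l m w (compose {..m} ?d \<alpha>)" if "\<alpha> \<in> ops m k'" for m \<alpha>
      using act_comp[OF ws d that] .
    have "k' < k" using lk l by simp
    from less.IH[OF this z \<gamma>(1) \<gamma>'(1)] eq obtain c \<nu> where \<nu>: "\<nu> \<in> ops c k'"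
      "\<gamma> ` {..a} \<union> \<gamma>' ` {..b} \<subseteq> \<nu> ` {..c}"
      "sharp X c (act X k' c ?z \<nu>) = sharp X a (act X k' a ?z \<gamma>)"
      unfolding zw[OF \<gamma>(1)] zw[OF \<gamma>'(1)] \<gamma>(2) \<gamma>'(2) by blast
    show ?thesis
    proof (intro exI conjI)
      show "compose {..c} ?d \<nu> \<in> ops c l" using d \<nu>(1) by (rule compose_ops)
      show "?\<tau> ` {..a} \<union> ?\<tau>' ` {..b} \<subseteq> compose {..c} ?d \<nu> ` {..c}"
        unfolding \<gamma>(2) \<gamma>'(2) compose_image using \<nu>(2) by blast
      show "sharp X c (act X l c w (compose {..c} ?d \<nu>)) = sharp X a (act X l a w ?\<tau>)"
        using \<nu>(3) zw[OF \<nu>(1)] zw[OF \<gamma>(1)] \<gamma>(2) by simp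
    qed
  qed
  then obtain c \<nu> where \<nu>: "\<nu> \<in> ops c l" "?\<tau> ` {..a} \<union> ?\<tau>' ` {..b} \<subseteq> \<nu> ` {..c}"
    "sharp X c (act X l c w \<nu>) = sharp X a (act X l a w ?\<tau>)" by blast
  \<comment> \<open>The full preimage under \<open>\<sigma>\<close> contains both vertex sets and
    still maps onto the image of \<open>\<nu>\<close>, so the non-degenerate part is kept.\<close>
  let ?A = "{i \<in> {..k}. \<sigma> i \<in> \<nu> ` {..c}}"
  have sub: "\<mu> ` {..a} \<union> \<mu>' ` {..b} \<subseteq> ?A"
    using \<nu>(2) ops_image[OF \<mu>] ops_image[OF \<mu>'] unfolding compose_image by auto
  have "\<mu> 0 \<in> ?A" using sub by auto
  then have "?A \<noteq> {}" by blast
  then obtain e \<kappa> where \<kappa>: "\<kappa> \<in> ops e k" "\<kappa> ` {..e} = ?A"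
    using ops_with_image[of ?A k] by (metis (no_types, lifting) mem_Collect_eq subsetI)
  have "\<sigma> ` ?A = \<nu> ` {..c}"
  proof (intro equalityI subsetI)
    fix j assume j: "j \<in> \<nu> ` {..c}"
    then have "j \<in> \<sigma> ` {..k}" using w(3) ops_image[OF \<nu>(1)] by blast
    then obtain i where "i \<in> {..k}" "j = \<sigma> i" by blast
    with j show "j \<in> \<sigma> ` ?A" by (intro image_eqI[of _ _ i]) simp_all
  qed auto
  then have "compose {..e} \<sigma> \<kappa> ` {..e} = \<nu> ` {..c}" using \<kappa>(2) by (simp only: compose_image)
  then have "sharp X e (act X l e w (compose {..e} \<sigma> \<kappa>)) = sharp X c (act X l c w \<nu>)"
    by (rule sharp_cong_image[OF ws compose_ops[OF w(2) \<kappa>(1)] \<nu>(1)])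
  then have "sharp X e (act X k e x \<kappa>) = sharp X a (act X k a x \<mu>)"
    unfolding xw[OF \<kappa>(1)] xw[OF \<mu>] \<nu>(3) .
  with \<kappa> sub show ?case by (intro exI[of _ e] exI[of _ \<kappa>]) simp
qed

text \<open>A section of the degeneracy exhibits the non-degenerate part \<open>w\<close> as a face
  of \<open>x\<close>, so faces of \<open>w\<close> are faces of \<open>x\<close>.\<close>

lemma face_of_sharp_lift:
  assumes x: "x \<in> smp X k" and le: "((d, v), sharp X k x) \<in> sharp_poset X"
  shows "\<exists>\<mu>. \<mu> \<in> ops d k \<and> inj_on \<mu> {..d} \<and> v = act X k d x \<mu>"
proof -
  obtain l w \<sigma> where w: "sharp X k x = (l, w)" "w \<in> nondeg X l" "\<sigma> \<in> ops k l" "\<sigma> ` {..k} = {..l}"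
    "x = act X l k w \<sigma>" using x by (rule sharpE)
  obtain \<mu> where \<mu>: "\<mu> \<in> ops d l" "inj_on \<mu> {..d}" "v = act X l d w \<mu>" "v \<in> nondeg X d"
    using le unfolding w(1) sharp_poset_iff by blast
  obtain s where s: "s \<in> ops l k" "compose {..l} \<sigma> s = id_op l"
    using ops_section[OF w(3,4)] by metis
  have s\<mu>: "compose {..d} s \<mu> \<in> ops d k" using s(1) \<mu>(1) by (rule compose_ops)
  have ws: "w \<in> smp X l" using w(2) by (rule nondeg_smp)
  have "w = act X k l x s"
    using act_comp[OF ws w(3) s(1)] act_id[OF ws] s(2) w(5) by simp
  then have "v = act X k d x (compose {..d} s \<mu>)"
    using act_comp[OF x s(1) \<mu>(1)] \<mu>(3) by simp
  with s\<mu> nondeg_inj[OF \<mu>(4) x s\<mu>] show ?thesis by blast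
qed

end

section \<open>The map of posets induced by a simplex\<close>

lemma nondeg_std_simplex: "nondeg (std_simplex n) k = {\<alpha> \<in> ops k n. inj_on \<alpha> {..k}}"
proof -
  interpret simplicial_set "std_simplex n" unfolding std_simplex_def by (rule simplicial_set_nerve)
  have "inj_on \<alpha> {..k}" if "\<alpha> \<in> nondeg (std_simplex n) k" for \<alpha>
  \<comment> \<open>Each operator is the result of applying itself to
    \<open>id_op n\<close>.\<close>
  proof (rule nondeg_inj[OF that])
    have \<alpha>: "\<alpha> \<in> ops k n" using nondeg_smp[OF that] by simp
    then show "\<alpha> \<in> ops k n" .
    show "id_op n \<in> smp (std_simplex n) n" by simp
    show "\<alpha> = act (std_simplex n) n k (id_op n) \<alpha>"
      using \<alpha> ops_le[OF \<alpha>] by (auto simp: compose_def id_op_def fun_eq_iff ops_iff PiE_iff extensional_def)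
  qed
  moreover have "\<alpha> \<in> nondeg (std_simplex n) k" if \<alpha>: "\<alpha> \<in> ops k n" "inj_on \<alpha> {..k}" for \<alpha>
  proof -
    have False if "m < k" "w \<in> ops m n" "\<sigma> \<in> ops k m" "\<alpha> = compose {..k} w \<sigma>" for m w \<sigma>
    proof -
      have "inj_on \<sigma> {..k}"
        using \<alpha>(2) unfolding that(4) inj_on_def compose_def by simp
      with ops_inj_le[OF that(3)] that(1) show False by simp
    qed
    with \<alpha>(1) show ?thesis unfolding nondeg_def by auto
  qed
  ultimately show ?thesis by (auto dest: nondeg_smp)
qed

text \<open>A point \<open>(k, \<alpha>)\<close> of the source is sent to the non-degenerate part of
  \<open>?x\<close>, the face of \<open>y\<close> along \<open>\<alpha>\<close>. Points below it are
  faces of \<open>?x\<close>, so \<open>face_of_sharp_lift\<close> provides lifts and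
  \<open>sharp_directed\<close> upper bounds.\<close>

theorem theorem1p4:
  fixes X :: "'a sset" and n :: nat and y :: 'a
  assumes "simplicial_set X" and "regular X" and "y \<in> smp X n"
  shows "let P = sharp_poset (std_simplex n); R = sharp_poset X; \<phi> = sharp_map X (repr_map X n y)
         in simplicial_iso (desing (top_cylinder P R \<phi>)) (red_cylinder P R \<phi>) (dcr P R \<phi>)"
proof -
  interpret X: simplicial_set X by fact
  interpret D: simplicial_set "std_simplex n" unfolding std_simplex_def by (rule simplicial_set_nerve)
  let ?P = "sharp_poset (std_simplex n)" and ?R = "sharp_poset X"
    and ?\<phi> = "sharp_map X (repr_map X n y)"
  have \<phi>: "?\<phi> (k, \<alpha>) = sharp X k (act X n k y \<alpha>)" for k \<alpha>
    by (simp add: sharp_map_def repr_map_def)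
  have P_le: "((m, \<beta>), (k, \<alpha>)) \<in> ?P \<longleftrightarrow> \<alpha> \<in> ops k n \<and> inj_on \<alpha> {..k} \<and> \<beta> \<in> ops m n \<and>
      inj_on \<beta> {..m} \<and> (\<exists>\<mu>\<in>ops m k. inj_on \<mu> {..m} \<and> \<beta> = compose {..m} \<alpha> \<mu>)" for m \<beta> k \<alpha>
    by (auto simp: sharp_poset_iff nondeg_std_simplex)
  have face: "((m, compose {..m} \<alpha> \<mu>), (k, \<alpha>)) \<in> ?P"
    if "\<alpha> \<in> ops k n" "inj_on \<alpha> {..k}" "\<mu> \<in> ops m k" "inj_on \<mu> {..m}" for m \<mu> k \<alpha>
  proof -
    have "inj_on (compose {..m} \<alpha> \<mu>) {..m}"
      using that ops_le[OF that(3)] by (auto simp: inj_on_def compose_def)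
    with that show ?thesis unfolding P_le by (auto intro: compose_ops)
  qed
  interpret directed_cylinder ?P ?R ?\<phi>
  proof
    show "Partial_order ?P" by (rule D.Partial_order_sharp_poset)
    show "Partial_order ?R" by (rule X.Partial_order_sharp_poset)
    show "order_preserving ?P ?R ?\<phi>"
      using D.simplicial_set_axioms assms(1) X.simplicial_map_repr_map[OF assms(3)]
      by (rule order_preserving_sharp_map)
  next
    fix r p assume r: "(r, ?\<phi> p) \<in> ?R" and p: "p \<in> Field ?P"
    obtain k \<alpha> where \<alpha>: "p = (k, \<alpha>)" "\<alpha> \<in> ops k n" "inj_on \<alpha> {..k}"
      using p by (auto simp: D.Field_sharp_poset nondeg_std_simplex)
    obtain d v where dv: "r = (d, v)" by (cases r)
    let ?x = "act X n k y \<alpha>"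
    have x: "?x \<in> smp X k" using assms(3) \<alpha>(2) by (rule X.act_closed)
    have v: "v \<in> nondeg X d" using r unfolding dv \<alpha>(1) by (cases "?\<phi> (k, \<alpha>)") (simp add: sharp_poset_iff)
    obtain \<mu> where \<mu>: "\<mu> \<in> ops d k" "inj_on \<mu> {..d}" "v = act X k d ?x \<mu>"
      using X.face_of_sharp_lift[OF x] r unfolding \<alpha>(1) \<phi> dv by blast
    have "?\<phi> (d, compose {..d} \<alpha> \<mu>) = r"
      using X.act_comp[OF assms(3) \<alpha>(2) \<mu>(1)] \<mu>(3) X.sharp_nondeg[OF v] by (simp add: \<phi> dv)
    with face[OF \<alpha>(2,3) \<mu>(1,2)] \<alpha>(1) show "\<exists>q. (q, p) \<in> ?P \<and> ?\<phi> q = r" by blast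
  next
    fix q p q' assume q: "(q, p) \<in> ?P" "(q', p) \<in> ?P" and eq: "?\<phi> q = ?\<phi> q'"
    obtain k \<alpha> a \<beta> b \<beta>' where *: "p = (k, \<alpha>)" "q = (a, \<beta>)" "q' = (b, \<beta>')"
      by (metis surj_pair)
    obtain \<mu> where \<mu>: "\<alpha> \<in> ops k n" "inj_on \<alpha> {..k}" "\<mu> \<in> ops a k" "inj_on \<mu> {..a}"
      "\<beta> = compose {..a} \<alpha> \<mu>"
      using q(1) unfolding * P_le by blast
    obtain \<mu>' where \<mu>': "\<mu>' \<in> ops b k" "inj_on \<mu>' {..b}" "\<beta>' = compose {..b} \<alpha> \<mu>'"
      using q(2) unfolding * P_le by blast
    let ?x = "act X n k y \<alpha>"
    have x: "?x \<in> smp X k" using assms(3) \<mu>(1) by (rule X.act_closed)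
    have xa: "?\<phi> (m, compose {..m} \<alpha> \<kappa>) = sharp X m (act X k m ?x \<kappa>)" if "\<kappa> \<in> ops m k" for m \<kappa>
      using X.act_comp[OF assms(3) \<mu>(1) that] by (simp add: \<phi>)
    have "sharp X a (act X k a ?x \<mu>) = sharp X b (act X k b ?x \<mu>')"
      using eq xa[OF \<mu>(3)] xa[OF \<mu>'(1)] unfolding *(2,3) \<mu>(5) \<mu>'(3) by simp
    from X.sharp_directed[OF assms(2) x \<mu>(3) \<mu>'(1) this] obtain c \<nu> where
      \<nu>: "\<nu> \<in> ops c k" "\<mu> ` {..a} \<union> \<mu>' ` {..b} \<subseteq> \<nu> ` {..c}"
      "sharp X c (act X k c ?x \<nu>) = sharp X a (act X k a ?x \<mu>)" by blast
    \<comment> \<open>Points of \<open>?P\<close> are injective operators, which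
      \<open>\<nu>\<close> need not be; an injective operator with the same image gives the same
      non-degenerate part.\<close>
    obtain e \<kappa> where \<kappa>: "\<kappa> \<in> ops e k" "inj_on \<kappa> {..e}" "\<kappa> ` {..e} = \<nu> ` {..c}"
      using ops_with_image[OF ops_image[OF \<nu>(1)]] by (metis image_is_empty atMost_iff empty_iff le0)
    let ?m = "(e, compose {..e} \<alpha> \<kappa>)"
    have mp: "(?m, p) \<in> ?P" unfolding *(1) using \<mu>(1,2) \<kappa>(1,2) by (rule face)
    \<comment> \<open>Containment of vertex sets yields the face relation, by
      \<open>ops_factor\<close>.\<close>
    have below: "((i, compose {..i} \<alpha> \<iota>), ?m) \<in> ?P"
      if \<iota>: "\<iota> \<in> ops i k" "inj_on \<iota> {..i}" "\<iota> ` {..i} \<subseteq> \<kappa> ` {..e}" for i \<iota>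
    proof -
      obtain \<rho> where \<rho>: "\<rho> \<in> ops i e" "\<iota> = compose {..i} \<kappa> \<rho>"
        using ops_factor[OF \<iota>(1) \<kappa>(1,2) \<iota>(3)] .
      have "inj_on \<rho> {..i}" using \<iota>(2) unfolding \<rho>(2) inj_on_def compose_def by simp
      moreover have "compose {..i} \<alpha> \<iota> = compose {..i} (compose {..e} \<alpha> \<kappa>) \<rho>"
        unfolding \<rho>(2) by (rule compose_assoc) (use \<rho>(1) in \<open>auto simp: ops_iff PiE_iff\<close>)
      moreover have "compose {..e} \<alpha> \<kappa> \<in> ops e n" "inj_on (compose {..e} \<alpha> \<kappa>) {..e}"
        using mp unfolding *(1) P_le by blast+
      ultimately show ?thesis using face \<rho>(1) by simp
    qed
    have "?\<phi> ?m = ?\<phi> q"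
      using xa[OF \<kappa>(1)] xa[OF \<mu>(3)] X.sharp_cong_image[OF x \<kappa>(1) \<nu>(1) \<kappa>(3)] \<nu>(3)
      unfolding *(2) \<mu>(5) by simp
    moreover have "(q, ?m) \<in> ?P" "(q', ?m) \<in> ?P"
      unfolding * \<mu>(5) \<mu>'(3) using \<mu>(3,4) \<mu>'(1,2) \<nu>(2) \<kappa>(3) by (auto intro!: below)
    ultimately show "\<exists>m. (q, m) \<in> ?P \<and> (q', m) \<in> ?P \<and> (m, p) \<in> ?P \<and> ?\<phi> m = ?\<phi> q"
      using mp by blast
  qed
  show ?thesis unfolding Let_def by (rule simplicial_iso_dcr)
qed

end
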